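(* Let $h>0$ and assume $g$ satisfies (H). Fix $c>0$ and suppose $u_1(t,x)=\phi(\nu\cdot x+ct)$ and $u_2(t,x)=\psi(\nu\cdot x+ct)$ are two traveling fronts of equation (1) propagating at the same velocity $c$. Then there exists $s_0\in\mathbb{R}$ such that $\phi(s)=\psi(s+s_0)$ for all $s\in\mathbb{R}$.
   Context: Hypothesis (H): $g:\mathbb{R}_+\to\mathbb{R}_+$ is continuous and strictly increasing; $g(x)=x$ has exactly two nonnegative solutions $0$ and $\kappa>0$; $g$ is differentiable at $0,\kappa$ with $g'(0)>1$, $g'(\kappa)<1$; $g$ is $C^1$ near $\kappa$; and there exist $C>0$, $\theta\in(0,1]$, $\delta>0$ with $|g(u)/u-g'(0)|\le Cu^\theta$ for $u\in(0,\delta]$. Equation (1): $u_t(t,x)=\Delta u(t,x)-u(t,x)+g(u(t-h,x))$, $x\in\mathbb{R}^m$; $\nu\in\mathbb{R}^m$, $|\nu|=1$. A traveling front at velocity $c>0$ is a solution $u(t,x)=\phi(\nu\cdot x+ct)$ whose profile $\phi$ is $C^2$, positive, bounded, monotone, with $\phi(-\infty)=0$, $\phi(+\infty)=\kappa$, and satisfies $\phi''(s)-c\phi'(s)-\phi(s)+g(\phi(s-ch))=0$, $s\in\mathbb{R}$. *)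

theory Defs
  imports "HOL-Analysis.Analysis"
begin

definition hypH :: "(real \<Rightarrow> real) \<Rightarrow> real \<Rightarrow> bool" where
  "hypH g \<kappa> \<longleftrightarrow>
     continuous_on {0..} g \<and>
     strict_mono_on {0..} g \<and>
     (\<forall>x\<ge>0. g x \<ge> 0) \<and>
     \<kappa> > 0 \<and>
     {x. x \<ge> 0 \<and> g x = x} = {0, \<kappa>} \<and>
     (\<exists>d0 d\<kappa>. (g has_real_derivative d0) (at 0 within {0..}) \<and> d0 > 1 \<and>
                (g has_real_derivative d\<kappa>) (at \<kappa> within {0..}) \<and> d\<kappa> < 1 \<and>
                (\<exists>C \<theta> \<delta>. C > 0 \<and> 0 < \<theta> \<and> \<theta> \<le> 1 \<and> \<delta> > 0 \<and>
                   (\<forall>u. 0 < u \<and> u \<le> \<delta> \<longrightarrow> \<bar>g u / u - d0\<bar> \<le> C * u powr \<theta>))) \<and>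
     (\<exists>\<epsilon> > 0. \<exists>g'. (\<forall>x\<in>{\<kappa>-\<epsilon><..<\<kappa>+\<epsilon>}. (g has_real_derivative g' x) (at x)) \<and>
                    continuous_on {\<kappa>-\<epsilon><..<\<kappa>+\<epsilon>} g')"

text \<open>Profile of a traveling front u(t,x) = phi(nu.x + c t) of
  u_t = Delta u - u + g(u(t-h,x)): phi is C^2, positive, bounded, monotone,
  phi(-oo)=0, phi(+oo)=kappa, and phi'' - c phi' - phi + g(phi(s - c h)) = 0.\<close>
definition traveling_front ::
  "(real \<Rightarrow> real) \<Rightarrow> real \<Rightarrow> real \<Rightarrow> real \<Rightarrow> (real \<Rightarrow> real) \<Rightarrow> bool" where
  "traveling_front g \<kappa> h c \<phi> \<longleftrightarrow>
     (\<exists>\<phi>1 \<phi>2. (\<forall>s. (\<phi> has_real_derivative \<phi>1 s) (at s)) \<and>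
              (\<forall>s. (\<phi>1 has_real_derivative \<phi>2 s) (at s)) \<and>
              continuous_on UNIV \<phi>2 \<and>
              (\<forall>s. \<phi>2 s - c * \<phi>1 s - \<phi> s + g (\<phi> (s - c * h)) = 0)) \<and>
     (\<forall>s. \<phi> s > 0) \<and>
     bounded (range \<phi>) \<and>
     (mono \<phi> \<or> antimono \<phi>) \<and>
     (\<phi> \<longlongrightarrow> 0) at_bot \<and>
     (\<phi> \<longlongrightarrow> \<kappa>) at_top"

end

theory Submission
  imports Defs "HOL-Real_Asymp.Real_Asymp"
begin

text \<open>
  Write \<open>\<tau> = c h\<close>, \<open>p = g'(0)\<close> and \<open>char z = z\<^sup>2 - c z - 1 + p exp (- z \<tau>)\<close>. Let \<open>\<alpha> \<le> \<beta>\<close> be the two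
  positive zeros of \<open>char\<close>; their existence is forced by the existence of a front, since otherwise
  its exponential decay rate at \<open>-\<infinity>\<close> could be improved indefinitely. Then
  \<open>char z = (z - \<alpha>) (z - \<beta>) (1 + \<integral>\<^sub>0\<^sup>\<tau> k(s) exp (- z s) ds)\<close> with a \<^emph>\<open>nonnegative\<close> kernel \<open>k\<close>, so that
  the averaged profile \<open>W \<phi> t = \<phi> t + \<integral>\<^sub>0\<^sup>\<tau> k(s) \<phi>(t - s) ds\<close> solves the delay-free equation
  \<open>(D - \<alpha>) (D - \<beta>) (W \<phi>) = O(\<phi>\<^bsup>1 + \<theta>\<^esup>)\<close> and is therefore asymptotic at \<open>-\<infinity>\<close> to a positive
  multiple of \<open>exp (\<alpha> t)\<close> (or \<open>- t exp (\<alpha> t)\<close> if \<open>\<alpha> = \<beta>\<close>) or of \<open>exp (\<beta> t)\<close>.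

  The difference \<open>d\<close> of two ordered profiles satisfies \<open>d'' - c d' - d \<le> 0\<close>, which yields a Harnack
  inequality by which \<open>W d\<close> and \<open>d\<close> are comparable. Hence one can slide: \<open>\<phi> \<le> \<psi>(\<cdot> + a)\<close> persists while
  \<open>a\<close> decreases, as long as \<open>W \<psi> (t + a) / W \<phi> t\<close> has a limit larger than 1 at \<open>-\<infinity>\<close>; near \<open>\<kappa>\<close> the
  maximum principle applies because \<open>g'(\<kappa>) < 1\<close>. If the two asymptotic types differ, one may slide
  to \<open>a = -\<infinity>\<close>, which is absurd. If they agree, sliding in both directions down to the shift at which
  the ratio tends to 1 gives both inequalities.
\<close>

section \<open>Real-variable tools\<close>

lemma nondecreasing_of_deriv:
  fixes f f' :: "real \<Rightarrow> real"
  assumes "\<And>t. t \<le> T \<Longrightarrow> (f has_real_derivative f' t) (at t)" "\<And>t. t \<le> T \<Longrightarrow> f' t \<ge> 0" "x \<le> y" "y \<le> T"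
  shows "f x \<le> f y"
  by (rule DERIV_nonneg_imp_nondecreasing) (use assms in \<open>meson order_trans\<close>)+

lemma nonincreasing_of_deriv:
  fixes f f' :: "real \<Rightarrow> real"
  assumes "\<And>t. t \<le> T \<Longrightarrow> (f has_real_derivative f' t) (at t)" "\<And>t. t \<le> T \<Longrightarrow> f' t \<le> 0" "x \<le> y" "y \<le> T"
  shows "f y \<le> f x"
  by (rule DERIV_nonpos_imp_nonincreasing) (use assms in \<open>meson order_trans\<close>)+

text \<open>The integrating factor \<open>exp (- k * t)\<close> turns the differential inequality
  into monotonicity.\<close>

lemma exp_weight_mono:
  fixes f f' :: "real \<Rightarrow> real"
  assumes f: "\<And>t. t \<le> T \<Longrightarrow> (f has_real_derivative f' t) (at t)"
    and f': "\<And>t. t \<le> T \<Longrightarrow> k * f t \<le> f' t" and xy: "x \<le> y" "y \<le> T"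
  shows "f x \<le> exp (- k * (y - x)) * f y"
proof -
  have "exp (-k * x) * f x \<le> exp (-k * y) * f y"
  proof (rule nondecreasing_of_deriv[where T=T and f="\<lambda>t. exp (-k * t) * f t" and f'="\<lambda>t. exp (-k * t) * (f' t - k * f t)"])
    fix t assume t: "t \<le> T"
    show "((\<lambda>t. exp (-k * t) * f t) has_real_derivative exp (-k * t) * (f' t - k * f t)) (at t)"
      by (rule derivative_eq_intros f[OF t] refl)+ (simp add: algebra_simps)
    show "0 \<le> exp (-k * t) * (f' t - k * f t)" using f'[OF t] by simp
  qed (use xy in auto)
  then have "exp (k * x) * (exp (-k * x) * f x) \<le> exp (k * x) * (exp (-k * y) * f y)"
    by (intro mult_left_mono) auto
  moreover have "exp (k * x) * exp (-k * x) = 1" by (simp add: exp_minus)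
  moreover have "exp (- k * (y - x)) = exp (k * x) * exp (-k * y)"
    by (simp add: exp_add [symmetric] algebra_simps)
  ultimately show ?thesis by (simp only: mult.assoc [symmetric] mult_1_left)
qed

lemma exp_weight_antimono:
  fixes f f' :: "real \<Rightarrow> real"
  assumes f: "\<And>t. t \<le> T \<Longrightarrow> (f has_real_derivative f' t) (at t)"
    and f': "\<And>t. t \<le> T \<Longrightarrow> f' t \<le> k * f t" and xy: "x \<le> y" "y \<le> T"
  shows "f y \<le> exp (k * (y - x)) * f x"
proof -
  have "- f x \<le> exp (- k * (y - x)) * (- f y)"
    by (rule exp_weight_mono[where T=T and f'="\<lambda>t. - f' t"])
       (use f f' xy in \<open>auto intro: DERIV_minus\<close>)
  then have "exp (k * (y - x)) * (exp (- k * (y - x)) * f y) \<le> exp (k * (y - x)) * f x"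
    by (intro mult_left_mono) auto
  moreover have "exp (k * (y - x)) * exp (- k * (y - x)) = 1" by (simp add: exp_add [symmetric])
  ultimately show ?thesis by (simp only: mult.assoc [symmetric] mult_1_left)
qed

lemma has_deriv_comp_minus:
  fixes f :: "real \<Rightarrow> real"
  assumes "(f has_real_derivative f') (at (- t))"
  shows "((\<lambda>t. f (- t)) has_real_derivative - f') (at t)"
proof -
  have "(uminus has_real_derivative -1) (at t)" by (auto intro!: derivative_eq_intros)
  from DERIV_chain2[OF assms this] show ?thesis by simp
qed

lemma has_deriv_comp_shift:
  fixes f :: "real \<Rightarrow> real"
  assumes "(f has_real_derivative f') (at (t + a))"
  shows "((\<lambda>t. f (t + a)) has_real_derivative f') (at t)"
proof -
  have "((\<lambda>t. t + a) has_real_derivative 1) (at t)" by (auto intro!: derivative_eq_intros)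
  from DERIV_chain2[OF assms this] show ?thesis by simp
qed

text \<open>The operator factors as (D - m) (D - l), so z = d' - l d satisfies z' \<le> m z. Since m
  < 0, a positive value of z would make z grow exponentially towards -infinity; then d' \<ge> 1 on a
  left half-line, against the boundedness of \<open>d\<close>.\<close>

lemma superharmonic_upper:
  fixes d d1 d2 :: "real \<Rightarrow> real"
  assumes d: "\<And>t. (d has_real_derivative d1 t) (at t)" "\<And>t. (d1 has_real_derivative d2 t) (at t)"
    and B: "\<And>t. \<bar>d t\<bar> \<le> B"
    and ineq: "\<And>t. d2 t - (l + m) * d1 t + l * m * d t \<le> 0"
    and l: "l > 0" "m < 0"
  shows "d1 t \<le> l * d t"
proof (rule ccontr)
  assume neg: "\<not> ?thesis"
  define z where "z = (\<lambda>t. d1 t - l * d t)"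
  have zt: "z t > 0" using neg by (simp add: z_def)
  have B0: "B \<ge> 0" using B[of 0] by linarith
  have grow: "exp (m * (s - t)) * z t \<le> z s" if "s \<le> t" for s
  proof -
    have "z t \<le> exp (m * (t - s)) * z s"
    proof (rule exp_weight_antimono[where f'="\<lambda>t. d2 t - l * d1 t" and T = t])
      fix u
      show "(z has_real_derivative d2 u - l * d1 u) (at u)"
        unfolding z_def by (intro DERIV_diff DERIV_cmult d)
      show "d2 u - l * d1 u \<le> m * z u" using ineq[of u] by (simp add: z_def algebra_simps)
    qed (use that in auto)
    then have "exp (m * (s - t)) * z t \<le> exp (m * (s - t)) * (exp (m * (t - s)) * z s)"
      by (intro mult_left_mono) auto
    moreover have "exp (m * (s - t)) * exp (m * (t - s)) = 1"
      by (simp add: exp_add [symmetric] right_diff_distrib)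
    ultimately show ?thesis by (simp add: mult.assoc [symmetric])
  qed
  have "filterlim (\<lambda>s. exp (m * (s - t)) * z t) at_top at_bot"
  proof -
    have "filterlim (\<lambda>s. m * (s - t)) at_top at_bot"
      unfolding filterlim_at_top
    proof
      fix Z show "\<forall>\<^sub>F s in at_bot. Z \<le> m * (s - t)"
        using eventually_le_at_bot[of "t + Z / m"]
      proof eventually_elim
        case (elim s)
        then have "s - t \<le> Z / m" by simp
        then show ?case using l by (simp add: neg_le_divide_eq mult.commute)
      qed
    qed
    then have "filterlim (\<lambda>s. exp (m * (s - t))) at_top at_bot"
      by (rule filterlim_compose[OF exp_at_top])
    from filterlim_tendsto_pos_mult_at_top[OF tendsto_const zt this] show ?thesis
      by (simp add: mult.commute)
  qed
  then have "eventually (\<lambda>s. exp (m * (s - t)) * z t \<ge> l * B + 1) at_bot"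
    by (simp add: filterlim_at_top)
  then obtain s1 where s1: "\<And>s. s \<le> s1 \<Longrightarrow> exp (m * (s - t)) * z t \<ge> l * B + 1"
    by (auto simp: eventually_at_bot_linorder)
  define s0 where "s0 = min s1 t"
  have d1: "d1 s \<ge> 1" if "s \<le> s0" for s
  proof -
    have "z s \<ge> l * B + 1" using s1[of s] grow[of s] that by (simp add: s0_def)
    moreover have "l * d s \<ge> l * (-B)" using B[of s] l by (intro mult_left_mono) auto
    ultimately show ?thesis by (simp add: z_def)
  qed
  \<comment> \<open>With slope at least 1 on an interval of length \<open>2*B+1\<close>,
    \<open>d\<close> would rise by more than \<open>2*B\<close>, the largest variation that its
    bound permits.\<close>
  have "d (s0 - (2*B+1)) - (s0 - (2*B+1)) \<le> d s0 - s0"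
    by (rule nondecreasing_of_deriv[where T=s0 and f'="\<lambda>s. d1 s - 1"])
       (use d1 B0 in \<open>auto intro!: DERIV_diff DERIV_ident d\<close>)
  with B[of s0] B[of "s0 - (2*B+1)"] show False by linarith
qed

text \<open>Reflection: \<open>d (- t)\<close> satisfies the same kind of inequality with
  \<open>l\<close>, \<open>m\<close> replaced by \<open>- m\<close>, \<open>- l\<close>.\<close>

lemma superharmonic_lower:
  fixes d d1 d2 :: "real \<Rightarrow> real"
  assumes d: "\<And>t. (d has_real_derivative d1 t) (at t)" "\<And>t. (d1 has_real_derivative d2 t) (at t)"
    and B: "\<And>t. \<bar>d t\<bar> \<le> B"
    and ineq: "\<And>t. d2 t - (l + m) * d1 t + l * m * d t \<le> 0"
    and l: "l > 0" "m < 0"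
  shows "m * d t \<le> d1 t"
proof -
  have "- d1 (- (- t)) \<le> (- m) * d (- (- t))"
  proof (rule superharmonic_upper[where d="\<lambda>t. d (-t)" and ?d1.0="\<lambda>t. - d1 (-t)" and ?d2.0="\<lambda>t. d2 (-t)" and B=B and m="-l"])
    fix t
    show "((\<lambda>t. d (- t)) has_real_derivative - d1 (- t)) (at t)"
      by (rule has_deriv_comp_minus[OF d(1)])
    show "((\<lambda>t. - d1 (- t)) has_real_derivative d2 (- t)) (at t)"
      using DERIV_minus[OF has_deriv_comp_minus[OF d(2)]] by simp
    show "d2 (- t) - (- m + - l) * - d1 (- t) + - m * - l * d (- t) \<le> 0"
      using ineq[of "-t"] by (simp add: algebra_simps)
  qed (use B l in auto)
  then show ?thesis by simp
qed

text \<open>Differentiation under the integral hits \<open>f\<close>; integration by parts then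
  moves the derivative onto the kernel. For a kernel that solves a linear ODE, this closes up into
  an equation for the convolution itself.\<close>

lemma convolution_has_derivative:
  fixes k k' f f' :: "real \<Rightarrow> real"
  assumes k: "\<And>s. (k has_real_derivative k' s) (at s)" and k': "continuous_on UNIV k'"
    and f: "\<And>s. (f has_real_derivative f' s) (at s)" and f': "continuous_on UNIV f'"
    and r: "0 \<le> r"
  shows "((\<lambda>t. integral {0..r} (\<lambda>s. k s * f (t - s))) has_real_derivative
      k 0 * f t - k r * f (t - r) + integral {0..r} (\<lambda>s. k' s * f (t - s))) (at t)"
proof -
  have kc: "continuous_on A k" for A by (rule DERIV_continuous_on[OF has_field_derivative_at_within[OF k]])
  have fc: "continuous_on A f" for A by (rule DERIV_continuous_on[OF has_field_derivative_at_within[OF f]])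
  note [continuous_intros] = continuous_on_compose2[OF kc[of UNIV]] continuous_on_compose2[OF fc[of UNIV]]
    continuous_on_compose2[OF k'] continuous_on_compose2[OF f']
  have 1: "((\<lambda>t. integral (cbox 0 r) (\<lambda>s. k s * f (t - s))) has_real_derivative
      integral (cbox 0 r) (\<lambda>s. k s * f' (t - s))) (at t within UNIV)"
  proof (rule leibniz_rule_field_derivative[where fx="\<lambda>t s. k s * f' (t - s)"])
    fix x s :: real
    show "((\<lambda>x. k s * f (x - s)) has_real_derivative k s * f' (x - s)) (at x within UNIV)"
      using DERIV_cmult[OF has_deriv_comp_shift[OF f, of "-s" x], of "k s"] by simp
  next
    fix x :: real
    show "(\<lambda>s. k s * f (x - s)) integrable_on cbox 0 r"
      by (intro integrable_continuous continuous_intros) auto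
  qed (auto intro!: continuous_intros simp: case_prod_unfold)
  have 2: "((\<lambda>s. k' s * f (t - s) - k s * f' (t - s)) has_integral k r * f (t - r) - k 0 * f (t - 0)) {0..r}"
  proof (rule fundamental_theorem_of_calculus[OF r])
    fix s
    have "((\<lambda>s. f (t - s)) has_real_derivative f' (t - s) * (-1)) (at s)"
      using has_deriv_comp_minus[OF has_deriv_comp_shift[OF f], of t s] by (simp add: add.commute)
    then have "((\<lambda>s. k s * f (t - s)) has_real_derivative k' s * f (t - s) - k s * f' (t - s)) (at s)"
      by (auto intro!: derivative_eq_intros k)
    then show "((\<lambda>s. k s * f (t - s)) has_vector_derivative k' s * f (t - s) - k s * f' (t - s)) (at s within {0..r})"
      by (metis has_real_derivative_iff_has_vector_derivative has_vector_derivative_at_within)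
  qed
  have i1: "(\<lambda>s. k' s * f (t - s)) integrable_on {0..r}" and i2: "(\<lambda>s. k s * f' (t - s)) integrable_on {0..r}"
    by (intro integrable_continuous_interval continuous_intros; auto)+
  from integral_unique[OF 2] integral_diff[OF i1 i2]
  have "integral {0..r} (\<lambda>s. k s * f' (t - s)) = k 0 * f t - k r * f (t - r) + integral {0..r} (\<lambda>s. k' s * f (t - s))"
    by simp
  with 1 show ?thesis by simp
qed

text \<open>\<open>C / r * exp (r * t)\<close> is an antiderivative of the bound, for either sign of
  \<open>r\<close>.\<close>

lemma exp_bounded_derivative_mono:
  fixes f f' :: "real \<Rightarrow> real"
  assumes f: "\<And>t. t \<le> T \<Longrightarrow> (f has_real_derivative f' t) (at t)"
    and f': "\<And>t. t \<le> T \<Longrightarrow> \<bar>f' t\<bar> \<le> C * exp (r * t)" and r: "r \<noteq> 0" and xy: "x \<le> y" "y \<le> T"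
  shows "f x + C / r * exp (r * x) \<le> f y + C / r * exp (r * y)"
    and "f y - C / r * exp (r * y) \<le> f x - C / r * exp (r * x)"
proof -
  have e: "((\<lambda>t. C / r * exp (r * t)) has_real_derivative C * exp (r * t)) (at t)" for t
    using r by (auto intro!: derivative_eq_intros)
  show "f x + C / r * exp (r * x) \<le> f y + C / r * exp (r * y)"
  proof (rule nondecreasing_of_deriv[where f="\<lambda>t. f t + C / r * exp (r * t)" and f'="\<lambda>t. f' t + C * exp (r * t)" and T=T])
    fix t assume t: "t \<le> T"
    show "((\<lambda>t. f t + C / r * exp (r * t)) has_real_derivative f' t + C * exp (r * t)) (at t)"
      by (intro DERIV_add f t e)
    show "0 \<le> f' t + C * exp (r * t)" using f'[OF t] by linarith
  qed (use xy in auto)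
  show "f y - C / r * exp (r * y) \<le> f x - C / r * exp (r * x)"
  proof (rule nonincreasing_of_deriv[where f="\<lambda>t. f t - C / r * exp (r * t)" and f'="\<lambda>t. f' t - C * exp (r * t)" and T=T])
    fix t assume t: "t \<le> T"
    show "((\<lambda>t. f t - C / r * exp (r * t)) has_real_derivative f' t - C * exp (r * t)) (at t)"
      by (intro DERIV_diff f t e)
    show "f' t - C * exp (r * t) \<le> 0" using f'[OF t] by linarith
  qed (use xy in auto)
qed

text \<open>For r > 0 the bound is integrable at -infinity. The two monotone envelopes of
  \<open>f\<close> are ordered and their gap closes, so the infimum of the upper one is the limit,
  with an explicit rate.\<close>

lemma exp_small_derivative_limit:
  fixes f f' :: "real \<Rightarrow> real"
  assumes f: "\<And>t. t \<le> T \<Longrightarrow> (f has_real_derivative f' t) (at t)"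
    and f': "\<And>t. t \<le> T \<Longrightarrow> \<bar>f' t\<bar> \<le> C * exp (r * t)" and r: "r > 0"
  obtains L where "\<And>t. t \<le> T \<Longrightarrow> \<bar>f t - L\<bar> \<le> C / r * exp (r * t)"
proof -
  define u where "u = (\<lambda>t. f t + C / r * exp (r * t))"
  define l where "l = (\<lambda>t. f t - C / r * exp (r * t))"
  have "0 \<le> C * exp (r * T)" using f'[of T] by linarith
  then have C: "C \<ge> 0" by (simp add: zero_le_mult_iff)
  have u: "u x \<le> u y" if "x \<le> y" "y \<le> T" for x y
    unfolding u_def using exp_bounded_derivative_mono(1)[of T f f' C r x y] f f' r that by auto
  have l: "l y \<le> l x" if "x \<le> y" "y \<le> T" for x y
    unfolding l_def using exp_bounded_derivative_mono(2)[of T f f' C r x y] f f' r that by auto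
  have lu: "l x \<le> u y" if "x \<le> T" "y \<le> T" for x y
  proof -
    have m: "l z \<le> u z" for z using C r by (simp add: l_def u_def)
    show ?thesis using l[of "min x y" x] u[of "min x y" y] m[of "min x y"] that by linarith
  qed
  define L where "L = (INF t\<in>{..T}. u t)"
  show ?thesis
  proof
    fix t assume t: "t \<le> T"
    have "L \<le> u t" unfolding L_def using t lu[of T] by (intro cINF_lower bdd_belowI2[of _ "l T"]) auto
    moreover have "l t \<le> L" unfolding L_def using t lu[of t] by (intro cINF_greatest) auto
    ultimately show "\<bar>f t - L\<bar> \<le> C / r * exp (r * t)" by (simp add: u_def l_def abs_le_iff)
  qed
qed

text \<open>For r < 0 integration from t up to T costs a multiple of \<open>exp (r * t)\<close>.
  This weight does not fall below \<open>exp (r * T)\<close> for t \<le> T, so the constant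
  \<open>f T\<close> can be absorbed into it.\<close>

lemma exp_large_derivative_bound:
  fixes f f' :: "real \<Rightarrow> real"
  assumes f: "\<And>t. t \<le> T \<Longrightarrow> (f has_real_derivative f' t) (at t)"
    and f': "\<And>t. t \<le> T \<Longrightarrow> \<bar>f' t\<bar> \<le> C * exp (r * t)" and r: "r < 0"
  obtains C' where "\<And>t. t \<le> T \<Longrightarrow> \<bar>f t\<bar> \<le> C' * exp (r * t)"
proof -
  have "0 \<le> C * exp (r * T)" using f'[of T] by linarith
  then have C: "C \<ge> 0" by (simp add: zero_le_mult_iff)
  show ?thesis
  proof
    fix t assume t: "t \<le> T"
    have u: "f t + C / r * exp (r * t) \<le> f T + C / r * exp (r * T)"
      using exp_bounded_derivative_mono(1)[of T f f' C r t T] f f' r t by auto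
    have l: "f t - C / r * exp (r * t) \<ge> f T - C / r * exp (r * T)"
      using exp_bounded_derivative_mono(2)[of T f f' C r t T] f f' r t by auto
    have "C / r * exp (r * T) \<le> 0" using C r by (simp add: divide_nonneg_neg mult_nonpos_nonneg)
    then have "\<bar>f t\<bar> \<le> \<bar>f T\<bar> + (- C / r) * exp (r * t)" using u l by (simp add: abs_le_iff) linarith
    also have "\<bar>f T\<bar> \<le> \<bar>f T\<bar> * exp (- r * T) * exp (r * t)"
    proof -
      have "1 \<le> exp (- r * T) * exp (r * t)" using r t by (simp add: exp_add[symmetric] mult_left_mono_neg)
      from mult_left_mono[OF this, of "\<bar>f T\<bar>"] show ?thesis by (simp add: mult.assoc)
    qed
    finally show "\<bar>f t\<bar> \<le> (\<bar>f T\<bar> * exp (- r * T) + (- C / r)) * exp (r * t)"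
      by (simp add: algebra_simps)
  qed
qed

lemma lhopital_at_bot:
  fixes f g :: "real \<Rightarrow> real"
  assumes g: "filterlim g at_top at_bot" and g': "\<And>x. g' x \<noteq> 0"
    and Df: "\<And>x. (f has_real_derivative f' x) (at x)" and Dg: "\<And>x. (g has_real_derivative g' x) (at x)"
    and lim: "((\<lambda>x. f' x / g' x) \<longlongrightarrow> L) at_bot"
  shows "((\<lambda>x. f x / g x) \<longlongrightarrow> L) at_bot"
proof -
  have "((\<lambda>x. f (-x) / g (-x)) \<longlongrightarrow> L) at_top"
  proof (rule lhospital_at_top_at_top[where g'="\<lambda>x. - g' (-x)" and f'="\<lambda>x. - f' (-x)"])
    show "LIM x at_top. g (- x) :> at_top"
      by (rule filterlim_compose[OF g filterlim_uminus_at_bot_at_top])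
    have "((\<lambda>x. f' (-x) / g' (-x)) \<longlongrightarrow> L) at_top"
      by (rule filterlim_compose[OF lim filterlim_uminus_at_bot_at_top])
    then show "((\<lambda>x. - f' (- x) / - g' (- x)) \<longlongrightarrow> L) at_top" by simp
    show "\<forall>\<^sub>F x in at_top. ((\<lambda>x. f (- x)) has_real_derivative - f' (- x)) (at x)"
      by (intro always_eventually allI has_deriv_comp_minus Df)
    show "\<forall>\<^sub>F x in at_top. ((\<lambda>x. g (- x)) has_real_derivative - g' (- x)) (at x)"
      by (intro always_eventually allI has_deriv_comp_minus Dg)
  qed (use g' in auto)
  from filterlim_compose[OF this filterlim_uminus_at_top_at_bot] show ?thesis by simp
qed

section \<open>Profiles and their flux\<close>

text \<open>Here \<tau> stands for c h and \<open>p\<close> for g'(0). The numbers \<open>l\<close>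
  and \<open>m\<close> are the roots of z^2 - c z - 1, so that d'' - c d' - d factors;
  \<open>g_contr\<close> is the local contraction that g'(\<kappa>) < 1 provides.\<close>

locale delayed_monostable =
  fixes g :: "real \<Rightarrow> real" and \<kappa> \<tau> c p l m C \<theta> \<delta> \<epsilon> q :: real
  assumes \<tau>: "\<tau> > 0" and c: "c > 0" and \<kappa>: "\<kappa> > 0"
    and g_mono: "\<And>x y. 0 \<le> x \<Longrightarrow> x \<le> y \<Longrightarrow> g x \<le> g y"
    and g_nonneg: "\<And>x. 0 \<le> x \<Longrightarrow> 0 \<le> g x" and g\<kappa>: "g \<kappa> = \<kappa>"
    and p: "p > 1" and C: "C > 0" and \<theta>: "\<theta> > 0" and \<delta>: "\<delta> > 0"
    and g_zero: "\<And>u. 0 < u \<Longrightarrow> u \<le> \<delta> \<Longrightarrow> \<bar>g u - p * u\<bar> \<le> C * u powr (1 + \<theta>)"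
    and \<epsilon>: "\<epsilon> > 0" and q: "0 \<le> q" "q < 1"
    and g_contr: "\<And>u v. \<kappa> - \<epsilon> \<le> u \<Longrightarrow> u \<le> v \<Longrightarrow> v \<le> \<kappa> \<Longrightarrow> g v - g u \<le> q * (v - u)"
    and l: "l > 0" and m: "m < 0" and lm: "l + m = c" "l * m = -1"
begin

text \<open>The characteristic function at 0: \<open>exp (z * t)\<close> solves the equation
  linearised at 0 iff \<open>char z = 0\<close>.\<close>

definition char :: "real \<Rightarrow> real" where
  "char z = z\<^sup>2 - c * z - 1 + p * exp (- z * \<tau>)"

definition front :: "(real \<Rightarrow> real) \<Rightarrow> (real \<Rightarrow> real) \<Rightarrow> (real \<Rightarrow> real) \<Rightarrow> bool" where
  "front f f1 f2 \<longleftrightarrow>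
     (\<forall>t. (f has_real_derivative f1 t) (at t)) \<and> (\<forall>t. (f1 has_real_derivative f2 t) (at t)) \<and>
     (\<forall>t. f2 t - c * f1 t - f t + g (f (t - \<tau>)) = 0) \<and>
     (\<forall>t. 0 < f t) \<and> (\<forall>t. f t \<le> \<kappa>) \<and> mono f \<and> (f \<longlongrightarrow> 0) at_bot \<and> (f \<longlongrightarrow> \<kappa>) at_top"

definition exp_order :: "(real \<Rightarrow> real) \<Rightarrow> real \<Rightarrow> bool" where
  "exp_order f \<gamma> \<longleftrightarrow> (\<exists>K. \<forall>t\<le>0. f t \<le> K * exp (\<gamma> * t))"

text \<open>The optimal exponential decay rate at -infinity. For a front the set is nonempty by
  \<open>exp_order_0\<close> and bounded by \<open>exp_order_le\<close>.\<close>

definition sup_order :: "(real \<Rightarrow> real) \<Rightarrow> real" where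
  "sup_order f = Sup {\<gamma>. exp_order f \<gamma>}"

lemma frontD:
  assumes "front f f1 f2"
  shows "(f has_real_derivative f1 t) (at t)" "(f1 has_real_derivative f2 t) (at t)"
    "f2 t - c * f1 t - f t + g (f (t - \<tau>)) = 0"
    "0 < f t" "f t \<le> \<kappa>" "mono f" "(f \<longlongrightarrow> 0) at_bot" "(f \<longlongrightarrow> \<kappa>) at_top"
  using assms by (auto simp: front_def)

text \<open>Both factors of d'' - c d' - d = (D - l) (D - m) d give one-sided bounds on the
  logarithmic growth of \<open>d\<close>. Integrating them compares values at different points, and
  so positivity spreads from one point to the whole line.\<close>

lemma harnack:
  fixes d d1 d2 :: "real \<Rightarrow> real"
  assumes d: "\<And>t. (d has_real_derivative d1 t) (at t)" "\<And>t. (d1 has_real_derivative d2 t) (at t)"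
    and B: "\<And>t. \<bar>d t\<bar> \<le> B"
    and ineq: "\<And>t. d2 t - c * d1 t - d t \<le> 0"
  shows "d1 t \<le> l * d t" "m * d t \<le> d1 t"
    and "s \<le> t \<Longrightarrow> d t \<le> exp (l * (t - s)) * d s" "s \<le> t \<Longrightarrow> d s \<le> exp (- m * (t - s)) * d t"
    and "d s > 0 \<Longrightarrow> d t > 0"
proof -
  have i: "d2 t - (l + m) * d1 t + l * m * d t \<le> 0" for t
    using ineq[of t] lm by simp
  show 1: "d1 t \<le> l * d t" for t by (rule superharmonic_upper[OF d B i l m])
  show 2: "m * d t \<le> d1 t" for t by (rule superharmonic_lower[OF d B i l m])
  show 3: "s \<le> t \<Longrightarrow> d t \<le> exp (l * (t - s)) * d s" for s t
    by (rule exp_weight_antimono[OF d(1) 1]) auto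
  show 4: "s \<le> t \<Longrightarrow> d s \<le> exp (- m * (t - s)) * d t" for s t
    by (rule exp_weight_mono[OF d(1) 2]) auto
  show "d t > 0" if "d s > 0"
  proof (cases "s \<le> t")
    case True
    then show ?thesis using 4[of s t] that by (metis exp_gt_zero less_le_trans zero_less_mult_pos)
  next
    case False
    then show ?thesis using 3[of t s] that by (metis exp_gt_zero less_le_trans zero_less_mult_pos linear)
  qed
qed

lemma front_superharmonic:
  assumes F: "front f f1 f2"
  shows "f2 t - c * f1 t - f t \<le> 0"
  using frontD(3)[OF F, of t] g_nonneg[OF less_imp_le[OF frontD(4)[OF F]], of "t - \<tau>"] by linarith

lemma front_bounded: "front f f1 f2 \<Longrightarrow> \<bar>f t\<bar> \<le> \<kappa>"
  using frontD(4,5)[of f f1 f2 t] by simp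

lemma front_harnack:
  assumes F: "front f f1 f2"
  shows "f1 t \<le> l * f t" "s \<le> t \<Longrightarrow> f t \<le> exp (l * (t - s)) * f s"
  by (rule harnack(1,3)[OF frontD(1,2)[OF F] front_bounded[OF F] front_superharmonic[OF F]])+

lemma front_deriv_nonneg:
  assumes F: "front f f1 f2"
  shows "0 \<le> f1 t"
  using mono_on_imp_deriv_nonneg[OF _ frontD(1)[OF F, of t], of UNIV] frontD(6)[OF F] by simp

text \<open>A strong maximum principle: \<kappa> - f is again a supersolution because g(f) \<le>
  g(\<kappa>) = \<kappa>, and it is positive far to the left.\<close>

lemma front_less:
  assumes F: "front f f1 f2"
  shows "f t < \<kappa>"
proof -
  have "\<exists>s. f s < \<kappa>"
    using order_tendstoD(2)[OF frontD(7)[OF F] \<kappa>] by (auto simp: eventually_at_bot_linorder)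
  then obtain s where s: "\<kappa> - f s > 0" by auto
  have "\<kappa> - f t > 0"
  proof (rule harnack(5)[where d="\<lambda>t. \<kappa> - f t" and ?d1.0="\<lambda>t. - f1 t" and ?d2.0="\<lambda>t. - f2 t" and B=\<kappa> and s=s])
    fix t
    show "((\<lambda>t. \<kappa> - f t) has_real_derivative - f1 t) (at t)"
      using DERIV_diff[OF DERIV_const frontD(1)[OF F]] by simp
    show "((\<lambda>t. - f1 t) has_real_derivative - f2 t) (at t)"
      by (intro DERIV_minus frontD(2)[OF F])
    show "\<bar>\<kappa> - f t\<bar> \<le> \<kappa>" using frontD(4,5)[OF F, of t] by simp
    show "- f2 t - c * - f1 t - (\<kappa> - f t) \<le> 0"
      using frontD(3)[OF F, of t] g_mono[OF less_imp_le[OF frontD(4)[OF F]] frontD(5)[OF F], of "t - \<tau>"] g\<kappa>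
      by simp
    show "0 < \<kappa> - f s" by (rule s)
  qed
  then show ?thesis by simp
qed

text \<open>The flux is what remains of the linearised operator after one factor
  \<open>d/dt - \<gamma>\<close> is split off.\<close>

definition flux :: "real \<Rightarrow> (real \<Rightarrow> real) \<Rightarrow> (real \<Rightarrow> real) \<Rightarrow> real \<Rightarrow> real" where
  "flux \<gamma> f f1 t = f1 t + (\<gamma> - c) * f t
     - p * exp (- \<gamma> * \<tau>) * integral {0..\<tau>} (\<lambda>s. exp (\<gamma> * s) * f (t - s))"

text \<open>The remainder of the nonlinearity after linearisation at 0; by \<open>g_zero\<close> it
  is of higher order in \<open>f\<close>.\<close>

definition defect :: "(real \<Rightarrow> real) \<Rightarrow> real \<Rightarrow> real" where
  "defect f t = g (f (t - \<tau>)) - p * f (t - \<tau>)"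

lemma front_continuous:
  assumes F: "front f f1 f2"
  shows "continuous_on A f" "continuous_on A f1"
  by (rule DERIV_continuous_on[OF has_field_derivative_at_within], rule frontD[OF F])+

text \<open>Differentiating the exponential kernel reproduces \<gamma> times the integral, while the
  boundary terms exchange the delayed linear term \<open>p * f (t - \<tau>)\<close> for an undelayed
  one. What is left over multiplies \<open>f t\<close> by \<open>char \<gamma>\<close>, so at a zero
  of \<open>char\<close> only the defect drives the flux.\<close>

lemma flux_has_derivative:
  assumes F: "front f f1 f2"
  shows "(flux \<gamma> f f1 has_real_derivative \<gamma> * flux \<gamma> f f1 t - defect f t - char \<gamma> * f t) (at t)"
proof -
  have "((\<lambda>t. integral {0..\<tau>} (\<lambda>s. exp (\<gamma> * s) * f (t - s))) has_real_derivative
      exp (\<gamma> * 0) * f t - exp (\<gamma> * \<tau>) * f (t - \<tau>) + integral {0..\<tau>} (\<lambda>s. \<gamma> * exp (\<gamma> * s) * f (t - s))) (at t)"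
    by (rule convolution_has_derivative[where f'=f1])
       (use \<tau> in \<open>auto intro!: derivative_eq_intros continuous_intros frontD[OF F] front_continuous[OF F]\<close>)
  then have I: "((\<lambda>t. integral {0..\<tau>} (\<lambda>s. exp (\<gamma> * s) * f (t - s))) has_real_derivative
      f t - exp (\<gamma> * \<tau>) * f (t - \<tau>) + \<gamma> * integral {0..\<tau>} (\<lambda>s. exp (\<gamma> * s) * f (t - s))) (at t)"
    by (simp add: mult.assoc)
  have e: "exp (\<gamma> * \<tau>) * exp (- (\<gamma> * \<tau>)) = 1"
    by (simp add: exp_minus)
  have f2: "f2 t = c * f1 t + f t - g (f (t - \<tau>))"
    using frontD(3)[OF F, of t] by linarith
  show ?thesis
    unfolding flux_def
    by (rule derivative_eq_intros I frontD[OF F] refl)+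
       (simp add: f2 defect_def char_def algebra_simps power2_eq_square e)
qed

text \<open>In the constant, \<open>l\<close> comes from f' \<le> l f, \<open>l + c\<close> bounds
  the coefficient \<gamma> - c, and \<open>p * \<tau>\<close> bounds the integral term, in which
  monotonicity replaces f(t - s) by f(t).\<close>

lemma flux_bound:
  assumes F: "front f f1 f2" and \<gamma>: "0 \<le> \<gamma>" "\<gamma> \<le> l"
  shows "\<bar>flux \<gamma> f f1 t\<bar> \<le> (2 * l + c + p * \<tau>) * f t"
proof -
  have f: "0 < f t" for t by (rule frontD(4)[OF F])
  have mono: "f x \<le> f y" if "x \<le> y" for x y using frontD(6)[OF F] that by (simp add: monoD)
  have b: "exp (\<gamma> * s) * f (t - s) \<le> exp (\<gamma> * \<tau>) * f t" if "s \<in> {0..\<tau>}" for s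
    using that \<gamma> f[of "t-s"] f[of t] by (intro mult_mono mono) (auto simp: mult_left_mono)
  have int: "(\<lambda>s. exp (\<gamma> * s) * f (t - s)) integrable_on {0..\<tau>}"
    by (intro integrable_continuous_interval continuous_intros continuous_on_compose2[OF front_continuous(1)[OF F, of UNIV]]) auto
  have i0: "0 \<le> integral {0..\<tau>} (\<lambda>s. exp (\<gamma> * s) * f (t - s))"
    by (rule integral_nonneg[OF int]) (use f in \<open>auto intro: less_imp_le\<close>)
  have i1: "integral {0..\<tau>} (\<lambda>s. exp (\<gamma> * s) * f (t - s)) \<le> \<tau> * (exp (\<gamma> * \<tau>) * f t)"
    using integral_le[OF int integrable_const_ivl b] \<tau> by (simp add: mult.left_commute)
  have "p * exp (- \<gamma> * \<tau>) * integral {0..\<tau>} (\<lambda>s. exp (\<gamma> * s) * f (t - s))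
      \<le> p * exp (- \<gamma> * \<tau>) * (\<tau> * (exp (\<gamma> * \<tau>) * f t))"
    using p by (intro mult_left_mono i1) auto
  also have "\<dots> = p * \<tau> * f t * (exp (- \<gamma> * \<tau>) * exp (\<gamma> * \<tau>))" by (simp only: ac_simps)
  also have "\<dots> = p * \<tau> * f t" by (simp add: exp_add [symmetric])
  finally have 1: "p * exp (- \<gamma> * \<tau>) * integral {0..\<tau>} (\<lambda>s. exp (\<gamma> * s) * f (t - s)) \<le> p * \<tau> * f t" .
  have 2: "0 \<le> p * exp (- \<gamma> * \<tau>) * integral {0..\<tau>} (\<lambda>s. exp (\<gamma> * s) * f (t - s))"
    using i0 p by simp
  have 3: "f1 t \<le> l * f t" by (rule front_harnack(1)[OF F])
  have 4: "0 \<le> f1 t" by (rule front_deriv_nonneg[OF F])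
  have 5: "\<bar>(\<gamma> - c) * f t\<bar> \<le> (l + c) * f t"
    unfolding abs_mult using f[of t] \<gamma> c by (intro mult_mono) auto
  have "(2 * l + c + p * \<tau>) * f t = l * f t + (l + c) * f t + p * \<tau> * f t" by (simp add: algebra_simps)
  with 1 2 3 4 5 show ?thesis unfolding flux_def by linarith
qed

end

section \<open>Decay at minus infinity\<close>

context delayed_monostable
begin

lemma front_le: "front f f1 f2 \<Longrightarrow> x \<le> y \<Longrightarrow> f x \<le> f y"
  by (meson frontD(6) monoD)

text \<open>A bound on any left half-line suffices: on the bounded remainder up to 0,
  \<open>f\<close> is at most \<kappa> and the weight is bounded below.\<close>

lemma exp_orderI:
  assumes F: "front f f1 f2" and K: "\<And>t. t \<le> T \<Longrightarrow> f t \<le> K * exp (\<gamma> * t)"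
  shows "exp_order f \<gamma>"
  unfolding exp_order_def
proof (intro exI allI impI)
  fix t :: real assume t: "t \<le> 0"
  show "f t \<le> (\<bar>K\<bar> + \<kappa> * exp (\<bar>\<gamma>\<bar> * \<bar>T\<bar>)) * exp (\<gamma> * t)"
  proof (cases "t \<le> T")
    case True
    have "f t \<le> K * exp (\<gamma> * t)" by (rule K[OF True])
    also have "\<dots> \<le> (\<bar>K\<bar> + \<kappa> * exp (\<bar>\<gamma>\<bar> * \<bar>T\<bar>)) * exp (\<gamma> * t)"
      using \<kappa> by (intro mult_right_mono add_increasing2) auto
    finally show ?thesis .
  next
    case False
    have "\<bar>\<gamma> * t\<bar> \<le> \<bar>\<gamma>\<bar> * \<bar>T\<bar>" unfolding abs_mult using False t by (intro mult_left_mono) auto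
    then have "exp 0 \<le> exp (\<bar>\<gamma>\<bar> * \<bar>T\<bar> + \<gamma> * t)" by (subst exp_le_cancel_iff) linarith
    then have "1 \<le> exp (\<bar>\<gamma>\<bar> * \<bar>T\<bar>) * exp (\<gamma> * t)" by (simp add: exp_add)
    then have "\<kappa> * 1 \<le> \<kappa> * (exp (\<bar>\<gamma>\<bar> * \<bar>T\<bar>) * exp (\<gamma> * t))"
      using \<kappa> by (intro mult_left_mono) auto
    moreover have "0 \<le> \<bar>K\<bar> * exp (\<gamma> * t)" by simp
    ultimately show ?thesis using frontD(5)[OF F, of t]
      by (simp only: distrib_right mult.assoc)
  qed
qed

lemma exp_order_mono:
  assumes F: "front f f1 f2" and "exp_order f \<gamma>" "\<gamma>' \<le> \<gamma>"
  shows "exp_order f \<gamma>'"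
proof -
  from assms(2) obtain K where K: "\<And>t. t \<le> 0 \<Longrightarrow> f t \<le> K * exp (\<gamma> * t)" by (auto simp: exp_order_def)
  have "K \<ge> 0" using K[of 0] frontD(4)[OF F, of 0] by simp
  show ?thesis
  proof (rule exp_orderI[OF F])
    fix t :: real assume t: "t \<le> 0"
    have "f t \<le> K * exp (\<gamma> * t)" by (rule K[OF t])
    also have "\<dots> \<le> K * exp (\<gamma>' * t)"
      using \<open>K \<ge> 0\<close> assms(3) t by (intro mult_left_mono) (auto intro: mult_right_mono_neg)
    finally show "f t \<le> K * exp (\<gamma>' * t)" .
  qed
qed

lemma exp_order_0:
  assumes F: "front f f1 f2"
  shows "exp_order f 0"
  by (rule exp_orderI[OF F, of 0 \<kappa>]) (use frontD(5)[OF F] in auto)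

text \<open>Faster decay than \<open>exp (l * t)\<close> would contradict the Harnack bound of
  \<open>f 0\<close> by \<open>exp (- l * t) * f t\<close>.\<close>

lemma exp_order_le:
  assumes F: "front f f1 f2" and "exp_order f \<gamma>"
  shows "\<gamma> \<le> l"
proof (rule ccontr)
  assume "\<not> \<gamma> \<le> l"
  define r where "r = \<gamma> - l"
  have r: "r > 0" using \<open>\<not> \<gamma> \<le> l\<close> by (simp add: r_def)
  from assms(2) obtain K where K: "\<And>t. t \<le> 0 \<Longrightarrow> f t \<le> K * exp (\<gamma> * t)" by (auto simp: exp_order_def)
  have "\<forall>\<^sub>F t in at_bot. f 0 \<le> K * exp (r * t)"
    using eventually_le_at_bot[of 0]
  proof eventually_elim
    case (elim t)
    have "f 0 \<le> exp (l * (0 - t)) * f t" by (rule front_harnack(2)[OF F elim])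
    also have "\<dots> \<le> exp (l * (0 - t)) * (K * exp (\<gamma> * t))" by (intro mult_left_mono K elim) auto
    also have "\<dots> = K * (exp (l * (0 - t)) * exp (\<gamma> * t))" by (simp only: ac_simps)
    also have "\<dots> = K * exp (r * t)" by (simp add: exp_add [symmetric] r_def algebra_simps)
    finally show ?case .
  qed
  moreover have "((\<lambda>t. K * exp (r * t)) \<longlongrightarrow> 0) at_bot"
    using r by real_asymp
  ultimately have "f 0 \<le> 0" by (intro tendsto_lowerbound) auto
  then show False using frontD(4)[OF F, of 0] by simp
qed

lemma sup_order:
  assumes F: "front f f1 f2"
  shows "\<gamma> < sup_order f \<Longrightarrow> exp_order f \<gamma>" "exp_order f \<gamma> \<Longrightarrow> \<gamma> \<le> sup_order f"
    "0 \<le> sup_order f" "sup_order f \<le> l"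
proof -
  have bdd: "bdd_above {\<gamma>. exp_order f \<gamma>}"
    by (rule bdd_aboveI[of _ l]) (auto intro: exp_order_le[OF F])
  have ne: "{\<gamma>. exp_order f \<gamma>} \<noteq> {}" using exp_order_0[OF F] by auto
  show "exp_order f \<gamma>" if "\<gamma> < sup_order f"
    using that exp_order_mono[OF F] less_cSup_iff[OF ne bdd] unfolding sup_order_def by fastforce
  show *: "\<gamma> \<le> sup_order f" if "exp_order f \<gamma>" for \<gamma>
    unfolding sup_order_def using that by (intro cSup_upper bdd) auto
  show "0 \<le> sup_order f" by (rule *[OF exp_order_0[OF F]])
  show "sup_order f \<le> l" unfolding sup_order_def
    using exp_order_le[OF F] by (intro cSup_least ne) auto
qed

lemma exp_order_tendsto:
  assumes F: "front f f1 f2" and "exp_order f \<gamma>" "\<gamma>' < \<gamma>"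
  shows "((\<lambda>t. exp (- \<gamma>' * t) * f t) \<longlongrightarrow> 0) at_bot"
proof -
  define r where "r = \<gamma> - \<gamma>'"
  have r: "r > 0" using assms(3) by (simp add: r_def)
  from assms(2) obtain K where K: "\<And>t. t \<le> 0 \<Longrightarrow> f t \<le> K * exp (\<gamma> * t)" by (auto simp: exp_order_def)
  have upper: "\<forall>\<^sub>F t in at_bot. exp (- \<gamma>' * t) * f t \<le> K * exp (r * t)"
    using eventually_le_at_bot[of 0]
  proof eventually_elim
    case (elim t)
    have "exp (- \<gamma>' * t) * f t \<le> exp (- \<gamma>' * t) * (K * exp (\<gamma> * t))" by (intro mult_left_mono K elim) auto
    also have "\<dots> = K * (exp (- \<gamma>' * t) * exp (\<gamma> * t))" by (simp only: ac_simps)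
    also have "\<dots> = K * exp (r * t)" by (simp add: exp_add [symmetric] r_def algebra_simps)
    finally show ?case .
  qed
  have lim: "((\<lambda>t. K * exp (r * t)) \<longlongrightarrow> 0) at_bot"
    using r by real_asymp
  have lower: "\<forall>\<^sub>F t in at_bot. 0 \<le> exp (- \<gamma>' * t) * f t"
    using frontD(4)[OF F] by (intro always_eventually) (auto intro: less_imp_le)
  show ?thesis by (rule tendsto_sandwich[OF lower upper tendsto_const lim])
qed

lemma defect_bound:
  assumes F: "front f f1 f2"
  obtains T where "\<And>t. t \<le> T \<Longrightarrow> \<bar>defect f t\<bar> \<le> C * f t powr (1 + \<theta>)"
proof -
  have "\<forall>\<^sub>F t in at_bot. f t < \<delta>" by (rule order_tendstoD(2)[OF frontD(7)[OF F] \<delta>])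
  then obtain T where T: "\<And>t. t \<le> T \<Longrightarrow> f t < \<delta>" by (auto simp: eventually_at_bot_linorder)
  show ?thesis
  proof
    fix t assume t: "t \<le> T"
    have "\<bar>defect f t\<bar> \<le> C * f (t - \<tau>) powr (1 + \<theta>)"
      unfolding defect_def using T[of "t - \<tau>"] t \<tau> frontD(4)[OF F, of "t - \<tau>"] by (intro g_zero) auto
    also have "\<dots> \<le> C * f t powr (1 + \<theta>)"
      using C \<tau> \<theta> frontD(4)[OF F, of "t - \<tau>"] by (intro mult_left_mono powr_mono2 front_le[OF F]) auto
    finally show "\<bar>defect f t\<bar> \<le> C * f t powr (1 + \<theta>)" .
  qed
qed

lemma defect_small:
  assumes F: "front f f1 f2" and e: "e > 0"
  obtains T where "\<And>t. t \<le> T \<Longrightarrow> \<bar>defect f t\<bar> \<le> e * f t"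
proof -
  obtain T where T: "\<And>t. t \<le> T \<Longrightarrow> \<bar>defect f t\<bar> \<le> C * f t powr (1 + \<theta>)" by (rule defect_bound[OF F]) auto
  have "((\<lambda>t. C * f t powr \<theta>) \<longlongrightarrow> C * 0 powr \<theta>) at_bot"
    by (intro tendsto_intros frontD(7)[OF F]) (use \<theta> frontD(4)[OF F] in \<open>auto intro!: always_eventually intro: less_imp_le\<close>)
  then have "\<forall>\<^sub>F t in at_bot. C * f t powr \<theta> < e"
    using e by (intro order_tendstoD(2)) auto
  then obtain T' where T': "\<And>t. t \<le> T' \<Longrightarrow> C * f t powr \<theta> < e" by (auto simp: eventually_at_bot_linorder)
  show ?thesis
  proof
    fix t assume t: "t \<le> min T T'"
    have "C * f t powr (1 + \<theta>) = (C * f t powr \<theta>) * f t"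
      using frontD(4)[OF F, of t] by (simp add: powr_add)
    also have "\<dots> \<le> e * f t"
      using T'[of t] t frontD(4)[OF F, of t] by (intro mult_right_mono) auto
    finally show "\<bar>defect f t\<bar> \<le> e * f t" using T[of t] t by simp
  qed
qed

text \<open>Where \<open>char \<gamma>\<close> is positive, the decay rate can be improved by a
  definite amount. The weighted negative flux \<open>X\<close> increases from 0 at -infinity, and
  its derivative dominates both exp(- \<gamma> t) f and, by \<open>flux_bound\<close>, a multiple of
  \<open>X\<close>. Hence \<open>X\<close> decays exponentially, and \<open>f\<close> inherits the
  extra rate from X'.\<close>

lemma exp_order_step:
  assumes F: "front f f1 f2" and \<gamma>: "0 \<le> \<gamma>" "\<gamma> \<le> l"
    and lim: "((\<lambda>t. exp (- \<gamma> * t) * f t) \<longlongrightarrow> 0) at_bot"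
    and \<mu>: "0 < \<mu>" "\<mu> \<le> char \<gamma>"
  shows "exp_order f (\<gamma> + \<mu> / (2 * (2 * l + c + p * \<tau>)))"
proof -
  define B where "B = 2 * l + c + p * \<tau>"
  define \<eta> where "\<eta> = \<mu> / (2 * B)"
  define X where "X = (\<lambda>t. - (exp (- \<gamma> * t) * flux \<gamma> f f1 t))"
  define X' where "X' = (\<lambda>t. exp (- \<gamma> * t) * (defect f t + char \<gamma> * f t))"
  have B: "B > 0" using l c p \<tau> by (simp add: B_def add_pos_pos)
  have f: "0 < f t" for t by (rule frontD(4)[OF F])
  have dX: "(X has_real_derivative X' t) (at t)" for t
    unfolding X_def X'_def
    by (rule derivative_eq_intros flux_has_derivative[OF F] refl)+ (simp add: algebra_simps)
  have absX: "\<bar>X t\<bar> \<le> B * (exp (- \<gamma> * t) * f t)" for t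
    using mult_left_mono[OF flux_bound[OF F \<gamma>, of t], of "exp (- \<gamma> * t)"]
    by (simp add: X_def abs_mult B_def ac_simps)
  \<comment> \<open>Half of \<mu> is spent on absorbing the defect.\<close>
  obtain T where T: "\<And>t. t \<le> T \<Longrightarrow> \<bar>defect f t\<bar> \<le> \<mu> / 2 * f t"
    using defect_small[OF F, of "\<mu> / 2"] \<mu> by auto
  have X'1: "\<mu> / 2 * (exp (- \<gamma> * t) * f t) \<le> X' t" if "t \<le> T" for t
  proof -
    have "\<mu> * f t \<le> char \<gamma> * f t" using \<mu> f[of t] by (intro mult_right_mono) auto
    then have "\<mu> / 2 * f t \<le> defect f t + char \<gamma> * f t" using T[OF that] by (simp add: abs_le_iff field_simps)
    from mult_left_mono[OF this, of "exp (- \<gamma> * t)"] show ?thesis by (simp add: X'_def ac_simps)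
  qed
  have X'0: "0 \<le> X' t" if "t \<le> T" for t
    using X'1[OF that] f[of t] \<mu> by (smt (verit) exp_gt_zero half_gt_zero mult_pos_pos)
  have lim0: "(X \<longlongrightarrow> 0) at_bot"
    by (rule tendsto_0_le[OF lim, of _ B])
       (use absX f in \<open>auto intro!: always_eventually simp: abs_mult mult.commute abs_of_pos[OF f]\<close>)
  have X0: "0 \<le> X t" if "t \<le> T" for t
  proof (rule tendsto_upperbound[OF lim0])
    show "\<forall>\<^sub>F s in at_bot. X s \<le> X t"
      using eventually_le_at_bot[of t]
      by eventually_elim (rule nondecreasing_of_deriv[OF dX X'0], use that in auto)
  qed simp
  \<comment> \<open>\<eta> is chosen such that \<eta> times the bound \<open>B\<close> on the flux
    is exactly the remaining half of \<mu>.\<close>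
  have X'2: "\<eta> * X t \<le> X' t" if "t \<le> T" for t
  proof -
    have "\<eta> * X t \<le> \<eta> * (B * (exp (- \<gamma> * t) * f t))"
      using absX[of t] \<mu> B by (intro mult_left_mono) (auto simp: \<eta>_def)
    also have "\<dots> = \<mu> / 2 * (exp (- \<gamma> * t) * f t)" using B by (simp add: \<eta>_def)
    finally show ?thesis using X'1[OF that] by linarith
  qed
  have Xexp: "X t \<le> exp (- \<eta> * (T - t)) * X T" if "t \<le> T" for t
    by (rule exp_weight_mono[OF dX X'2]) (use that in auto)
  have "exp_order f (\<gamma> + \<eta>)"
  proof (rule exp_orderI[OF F])
    fix t assume t: "t \<le> T - 1"
    \<comment> \<open>Averaging over a unit interval turns the decay of \<open>X\<close> into decay
      of X' at some point \<open>z\<close>; monotonicity of \<open>f\<close> brings it back to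
      \<open>t\<close>.\<close>
    obtain z where z: "z > t" "z < t + 1" "X (t + 1) - X t = (t + 1 - t) * X' z"
      using MVT2[of t "t+1" X X'] dX by auto
    have "\<mu> / 2 * (exp (- \<gamma> * (t + 1)) * f t) \<le> \<mu> / 2 * (exp (- \<gamma> * z) * f z)"
      using z \<mu> \<gamma> f[of t] by (intro mult_left_mono mult_mono front_le[OF F]) (auto simp: mult_left_mono)
    also have "\<dots> \<le> X' z" using z t by (intro X'1) auto
    also have "\<dots> \<le> X (t + 1)" using z(3) X0[of t] t by simp
    also have "\<dots> \<le> exp (- \<eta> * (T - (t + 1))) * X T" using t by (intro Xexp) auto
    finally have "2 / \<mu> * exp (\<gamma> * (t + 1)) * (\<mu> / 2 * (exp (- \<gamma> * (t + 1)) * f t))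
        \<le> 2 / \<mu> * exp (\<gamma> * (t + 1)) * (exp (- \<eta> * (T - (t + 1))) * X T)"
      using \<mu> by (intro mult_left_mono) auto
    also have "2 / \<mu> * exp (\<gamma> * (t + 1)) * (\<mu> / 2 * (exp (- \<gamma> * (t + 1)) * f t)) =
        (2 / \<mu> * (\<mu> / 2)) * (exp (\<gamma> * (t + 1)) * exp (- \<gamma> * (t + 1))) * f t" by (simp only: ac_simps)
    also have "\<dots> = f t" using \<mu> by (simp add: exp_add [symmetric])
    also have "2 / \<mu> * exp (\<gamma> * (t + 1)) * (exp (- \<eta> * (T - (t + 1))) * X T)
      = 2 / \<mu> * X T * (exp (\<gamma> * (t + 1)) * exp (- \<eta> * (T - (t + 1))))" by (simp only: ac_simps)
    also have "exp (\<gamma> * (t + 1)) * exp (- \<eta> * (T - (t + 1))) = exp (\<gamma> + \<eta> - \<eta> * T) * exp ((\<gamma> + \<eta>) * t)"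
      by (simp add: exp_add [symmetric] algebra_simps)
    finally show "f t \<le> (2 / \<mu> * X T * exp (\<gamma> + \<eta> - \<eta> * T)) * exp ((\<gamma> + \<eta>) * t)"
      by (simp only: mult.assoc)
  qed
  then show ?thesis by (simp add: \<eta>_def B_def)
qed

lemma char_continuous: "continuous_on A char"
  unfolding char_def by (intro continuous_intros)

lemma char_0: "char 0 > 0"
  using p by (simp add: char_def)

lemma char_l: "char l > 0"
proof -
  have "l\<^sup>2 - c * l - 1 = 0" using lm(2) unfolding lm(1)[symmetric] by (simp add: power2_eq_square algebra_simps)
  then show ?thesis using p by (simp add: char_def)
qed

text \<open>Without a zero, \<open>char\<close> has a positive minimum on the compact interval from
  0 to \<open>S\<close>. Then \<open>exp_order_step\<close> gains the same \<eta> for every rate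
  there, and a start within \<eta> of \<open>S\<close> overshoots the supremum.\<close>

lemma char_root_le_sup_order:
  assumes F: "front f f1 f2"
  shows "\<exists>z. 0 \<le> z \<and> z \<le> sup_order f \<and> char z = 0"
proof (rule ccontr)
  define S where "S = sup_order f"
  assume no: "\<not> ?thesis"
  have S: "0 \<le> S" "S \<le> l" using sup_order[OF F] by (auto simp: S_def)
  have pos: "char z > 0" if z: "0 \<le> z" "z \<le> S" for z
  proof (rule ccontr)
    assume "\<not> char z > 0"
    then obtain w where "0 \<le> w" "w \<le> z" "char w = 0"
      using IVT2'[of char z 0 0] z char_0 char_continuous by auto
    then show False using no z by (auto simp: S_def)
  qed
  obtain z0 where z0: "z0 \<in> {0..S}" "\<And>z. z \<in> {0..S} \<Longrightarrow> char z0 \<le> char z"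
    using continuous_attains_inf[of "{0..S}" char] S char_continuous by auto
  define \<mu> where "\<mu> = char z0"
  have \<mu>: "\<mu> > 0" using pos z0 by (auto simp: \<mu>_def)
  define \<eta> where "\<eta> = \<mu> / (2 * (2 * l + c + p * \<tau>))"
  have "2 * l + c + p * \<tau> > 0" using l c p \<tau> by (simp add: add_pos_pos)
  then have \<eta>: "\<eta> > 0" using \<mu> by (simp add: \<eta>_def)
  define \<gamma> where "\<gamma> = max 0 (S - \<eta> / 2)"
  have \<gamma>: "0 \<le> \<gamma>" "\<gamma> \<le> S" "\<gamma> + \<eta> > S" using \<eta> S by (auto simp: \<gamma>_def)
  \<comment> \<open>If \<gamma> = 0 (in particular if \<open>S\<close> = 0), the convergence of
    \<open>f\<close> to 0 already is the claim; otherwise a rate strictly between \<gamma> and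
    \<open>S\<close> is available.\<close>
  have "((\<lambda>t. exp (- \<gamma> * t) * f t) \<longlongrightarrow> 0) at_bot"
  proof (cases "\<gamma> = 0")
    case True
    then show ?thesis using frontD(7)[OF F] by simp
  next
    case False
    then have "\<gamma> < S" using \<eta> by (auto simp: \<gamma>_def)
    then obtain \<gamma>' where "\<gamma> < \<gamma>'" "\<gamma>' < S" using dense by blast
    then show ?thesis using exp_order_tendsto[OF F sup_order(1)[OF F]] by (auto simp: S_def)
  qed
  then have "exp_order f (\<gamma> + \<eta>)"
    unfolding \<eta>_def using \<gamma> S z0(2)[of \<gamma>] \<mu> by (intro exp_order_step[OF F]) (auto simp: \<mu>_def)
  then have "\<gamma> + \<eta> \<le> S" unfolding S_def by (rule sup_order(2)[OF F])
  then show False using \<gamma> by simp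
qed

end

section \<open>Asymptotics of the averaged profile\<close>

text \<open>The second zero \<beta> of \<open>char\<close> is encoded through the kernel: the ODE
  and \<open>k \<tau> = 0\<close> determine \<open>k\<close>, and the prescribed value at 0 then
  says that \<beta> is a zero, or a double one if \<alpha> = \<beta>.\<close>

locale monostable_roots = delayed_monostable +
  fixes \<alpha> \<beta> :: real and k :: "real \<Rightarrow> real"
  assumes \<alpha>: "0 < \<alpha>" and \<alpha>\<beta>: "\<alpha> \<le> \<beta>" and char_\<alpha>: "char \<alpha> = 0"
    and \<alpha>_least: "\<And>z. 0 \<le> z \<Longrightarrow> char z = 0 \<Longrightarrow> \<alpha> \<le> z"
    and k': "\<And>s. (k has_real_derivative \<beta> * k s - p * exp (- \<alpha> * \<tau>) * exp (\<alpha> * s)) (at s)"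
    and k\<tau>: "k \<tau> = 0" and k0: "k 0 = \<alpha> + \<beta> - c"
    and k_nonneg: "\<And>s. 0 \<le> s \<Longrightarrow> s \<le> \<tau> \<Longrightarrow> 0 \<le> k s"

section \<open>The two positive characteristic zeros and the averaging kernel\<close>

context delayed_monostable
begin

lemma char_has_derivative:
  "(char has_real_derivative 2 * z - c - p * \<tau> * exp (- z * \<tau>)) (at z)"
  unfolding char_def by (auto intro!: derivative_eq_intros)

text \<open>\<alpha> is the least zero. Its derivative \<open>D\<close> is nonpositive:
  \<open>D = 0\<close> is the double zero, while for \<open>D < 0\<close> the function dips below 0
  and returns to \<open>char l > 0\<close>, which yields a second zero.\<close>

lemma monostable_roots_exist:
  assumes "\<exists>z. 0 \<le> z \<and> z \<le> l \<and> char z = 0"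
  shows "\<exists>\<alpha> \<beta> k. monostable_roots g \<kappa> \<tau> c p l m C \<theta> \<delta> \<epsilon> q \<alpha> \<beta> k"
proof -
  define A where "A = {0..l} \<inter> char -` {0}"
  have "closed (char -` {0})"
    using char_continuous[of UNIV] by (intro closed_vimage) auto
  then have A: "compact A" unfolding A_def by (intro compact_Int_closed) auto
  moreover have "A \<noteq> {}" using assms by (auto simp: A_def)
  ultimately obtain \<alpha> where \<alpha>A: "\<alpha> \<in> A" "\<And>z. z \<in> A \<Longrightarrow> \<alpha> \<le> z"
    using continuous_attains_inf[of A "\<lambda>x. x"] by auto
  have \<alpha>: "0 < \<alpha>" "\<alpha> < l" "char \<alpha> = 0"
    using \<alpha>A(1) char_0 char_l by (auto simp: A_def less_le)
  have least: "\<alpha> \<le> z" if "0 \<le> z" "char z = 0" for z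
    using \<alpha>A(2)[of z] that \<alpha> by (cases "z \<le> l") (auto simp: A_def)
  define D where "D = 2 * \<alpha> - c - p * \<tau> * exp (- \<alpha> * \<tau>)"
  have dchar: "(char has_real_derivative D) (at \<alpha>)" unfolding D_def by (rule char_has_derivative)
  \<comment> \<open>Otherwise \<open>char\<close> would be negative just left of \<alpha>, and
    \<open>char 0 > 0\<close> would give a smaller zero.\<close>
  have "D \<le> 0"
  proof (rule ccontr)
    assume "\<not> D \<le> 0"
    then obtain e where e: "e > 0" "\<And>h. h > 0 \<Longrightarrow> h < e \<Longrightarrow> char (\<alpha> - h) < char \<alpha>"
      using DERIV_pos_inc_left[OF dchar] by auto
    define h where "h = min (e / 2) \<alpha>"
    have h: "0 < h" "h < e" "h \<le> \<alpha>" using e(1) \<alpha> by (auto simp: h_def)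
    have "char (\<alpha> - h) < 0" using e(2) h \<alpha> by simp
    then obtain z where "0 \<le> z" "z \<le> \<alpha> - h" "char z = 0"
      using IVT2'[of char "\<alpha> - h" 0 0] char_0 h char_continuous by auto
    then show False using least[of z] h by simp
  qed
  define q1 where "q1 = p * exp (- \<alpha> * \<tau>)"
  have q1: "q1 > 0" using p by (simp add: q1_def)
  have char_eq: "z\<^sup>2 - c * z - 1 + p * exp (- z * \<tau>) = 0" if "char z = 0" for z
    using that by (simp add: char_def)
  have "\<exists>\<beta> k. \<alpha> \<le> \<beta> \<and> (\<forall>s. (k has_real_derivative \<beta> * k s - q1 * exp (\<alpha> * s)) (at s)) \<and>
      k \<tau> = 0 \<and> k 0 = \<alpha> + \<beta> - c \<and> (\<forall>s. 0 \<le> s \<longrightarrow> s \<le> \<tau> \<longrightarrow> 0 \<le> k s)"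
  proof (cases "D = 0")
    case True
    \<comment> \<open>The limit for \<beta> tending to \<alpha> of the kernel in the case of
      distinct zeros.\<close>
    define k where "k = (\<lambda>s. q1 * exp (\<alpha> * s) * (\<tau> - s))"
    show ?thesis
    proof (intro exI[of _ \<alpha>] exI[of _ k] conjI allI impI)
      show "(k has_real_derivative \<alpha> * k s - q1 * exp (\<alpha> * s)) (at s)" for s
        unfolding k_def by (rule derivative_eq_intros refl)+ (simp add: algebra_simps)
      show "k 0 = \<alpha> + \<alpha> - c" using True by (simp add: k_def D_def q1_def algebra_simps)
    qed (use q1 in \<open>auto simp: k_def\<close>)
  next
    case False
    with \<open>D \<le> 0\<close> have "D < 0" by simp
    then obtain e where e: "e > 0" "\<And>h. h > 0 \<Longrightarrow> h < e \<Longrightarrow> char (\<alpha> + h) < char \<alpha>"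
      using DERIV_neg_dec_right[OF dchar] by auto
    define h where "h = min (e / 2) (l - \<alpha>)"
    have h: "0 < h" "h < e" "\<alpha> + h \<le> l" using e(1) \<alpha> by (auto simp: h_def)
    have "char (\<alpha> + h) < 0" using e(2) h \<alpha> by simp
    then obtain \<beta> where \<beta>: "\<alpha> + h \<le> \<beta>" "char \<beta> = 0"
      using IVT'[of char "\<alpha> + h" 0 l] char_l h char_continuous by auto
    have \<alpha>\<beta>: "\<alpha> < \<beta>" using \<beta> h by simp
    \<comment> \<open>The solution of the linear ODE for \<open>k\<close> that vanishes at
      \<tau>.\<close>
    define k where "k = (\<lambda>s. q1 * (exp (\<beta> * s + (\<alpha> - \<beta>) * \<tau>) - exp (\<alpha> * s)) / (\<alpha> - \<beta>))"
    show ?thesis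
    proof (intro exI[of _ \<beta>] exI[of _ k] conjI allI impI)
      show "\<alpha> \<le> \<beta>" using \<alpha>\<beta> by simp
      show "(k has_real_derivative \<beta> * k s - q1 * exp (\<alpha> * s)) (at s)" for s
      proof -
        have "(k has_real_derivative q1 * (\<beta> * exp (\<beta> * s + (\<alpha> - \<beta>) * \<tau>) - \<alpha> * exp (\<alpha> * s)) / (\<alpha> - \<beta>)) (at s)"
          unfolding k_def using \<alpha>\<beta> by (auto intro!: derivative_eq_intros)
        also have "q1 * (\<beta> * exp (\<beta> * s + (\<alpha> - \<beta>) * \<tau>) - \<alpha> * exp (\<alpha> * s)) / (\<alpha> - \<beta>) = \<beta> * k s - q1 * exp (\<alpha> * s)"
          unfolding k_def using \<alpha>\<beta> by (simp add: divide_simps) (simp add: algebra_simps)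
        finally show ?thesis .
      qed
      show "k \<tau> = 0" by (simp add: k_def algebra_simps)
      show "k 0 = \<alpha> + \<beta> - c"
      proof -
        \<comment> \<open>Subtracting the characteristic equations of \<alpha> and \<beta> and
          cancelling \<alpha> - \<beta> gives the value at 0.\<close>
        have "q1 * exp ((\<alpha> - \<beta>) * \<tau>) = p * exp (- \<beta> * \<tau>)"
          by (simp add: q1_def mult.assoc exp_add [symmetric] algebra_simps)
        then have "q1 * (exp ((\<alpha> - \<beta>) * \<tau>) - 1) = p * exp (- \<beta> * \<tau>) - p * exp (- \<alpha> * \<tau>)"
          by (simp only: right_diff_distrib mult_1_right) (simp add: q1_def)
        also have "\<dots> = (\<alpha>\<^sup>2 - c * \<alpha> - 1) - (\<beta>\<^sup>2 - c * \<beta> - 1)"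
          using char_eq[OF \<alpha>(3)] char_eq[OF \<beta>(2)] by linarith
        also have "\<dots> = (\<alpha> + \<beta> - c) * (\<alpha> - \<beta>)" by (simp add: algebra_simps power2_eq_square)
        finally have "q1 * (exp ((\<alpha> - \<beta>) * \<tau>) - 1) = (\<alpha> + \<beta> - c) * (\<alpha> - \<beta>)" .
        then show ?thesis using \<alpha>\<beta> by (simp add: k_def)
      qed
      fix s assume s: "0 \<le> s" "s \<le> \<tau>"
      have "(\<beta> - \<alpha>) * s \<le> (\<beta> - \<alpha>) * \<tau>" using s \<alpha>\<beta> by (intro mult_left_mono) auto
      then have "exp (\<beta> * s + (\<alpha> - \<beta>) * \<tau>) \<le> exp (\<alpha> * s)" by (simp add: algebra_simps)
      then show "0 \<le> k s" unfolding k_def using q1 \<alpha>\<beta>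
        by (intro divide_nonpos_neg mult_nonneg_nonpos) auto
    qed
  qed
  then obtain \<beta> k where "\<alpha> \<le> \<beta>" "\<And>s. (k has_real_derivative \<beta> * k s - q1 * exp (\<alpha> * s)) (at s)"
      "k \<tau> = 0" "k 0 = \<alpha> + \<beta> - c" "\<And>s. 0 \<le> s \<Longrightarrow> s \<le> \<tau> \<Longrightarrow> 0 \<le> k s" by blast
  then have "monostable_roots g \<kappa> \<tau> c p l m C \<theta> \<delta> \<epsilon> q \<alpha> \<beta> k"
    using \<alpha> least by unfold_locales (auto simp: q1_def)
  then show ?thesis by blast
qed

end

section \<open>The averaged profile and its first-order equation\<close>

context monostable_roots
begin

definition W :: "(real \<Rightarrow> real) \<Rightarrow> real \<Rightarrow> real" where
  "W f t = f t + integral {0..\<tau>} (\<lambda>s. k s * f (t - s))"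

definition W_const :: real where
  "W_const = 1 + exp (- m * \<tau>) * integral {0..\<tau>} k"

lemma k_continuous: "continuous_on A k"
  by (rule DERIV_continuous_on[OF has_field_derivative_at_within[OF k']])

lemma k_integrable:
  assumes "continuous_on UNIV f"
  shows "(\<lambda>s. k s * f (t - s)) integrable_on {0..\<tau>}"
  by (intro integrable_continuous_interval continuous_intros k_continuous continuous_on_compose2[OF assms]) auto

lemma W_const: "W_const \<ge> 1"
proof -
  have "0 \<le> integral {0..\<tau>} k"
    using k_nonneg by (intro integral_nonneg integrable_continuous_interval k_continuous) auto
  then show ?thesis by (simp add: W_const_def)
qed

text \<open>The lower bound is the nonnegativity of \<open>k\<close>. For the upper bound, the
  backward Harnack inequality compares all values of \<open>d\<close> in the delay window with
  \<open>d t\<close>.\<close>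

lemma W_bounds:
  assumes d: "continuous_on UNIV d" and d0: "\<And>s. 0 \<le> d s"
    and dt: "\<And>s. s \<le> t \<Longrightarrow> d s \<le> exp (- m * (t - s)) * d t"
  shows "d t \<le> W d t" "W d t \<le> W_const * d t"
proof -
  show "d t \<le> W d t"
    unfolding W_def using k_nonneg d0 by (auto intro!: integral_nonneg k_integrable d)
  have "integral {0..\<tau>} (\<lambda>s. k s * d (t - s)) \<le> integral {0..\<tau>} (\<lambda>s. k s * (exp (- m * \<tau>) * d t))"
  proof (rule integral_le)
    show "(\<lambda>s. k s * d (t - s)) integrable_on {0..\<tau>}" by (rule k_integrable[OF d])
    show "(\<lambda>s. k s * (exp (- m * \<tau>) * d t)) integrable_on {0..\<tau>}"
      by (intro integrable_continuous_interval continuous_intros k_continuous)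
    fix s assume s: "s \<in> {0..\<tau>}"
    have "d (t - s) \<le> exp (- m * s) * d t" using dt[of "t - s"] s by simp
    also have "\<dots> \<le> exp (- m * \<tau>) * d t"
      using s m d0 by (intro mult_right_mono) (auto simp: mult_left_mono_neg)
    finally show "k s * d (t - s) \<le> k s * (exp (- m * \<tau>) * d t)"
      using k_nonneg s by (intro mult_left_mono) auto
  qed
  also have "\<dots> = exp (- m * \<tau>) * integral {0..\<tau>} k * d t"
    by (simp add: mult.commute)
  finally show "W d t \<le> W_const * d t" by (simp add: W_def W_const_def algebra_simps)
qed

lemma W_diff:
  assumes "continuous_on UNIV f" "continuous_on UNIV h"
  shows "W (\<lambda>t. h (t + a) - f t) t = W h (t + a) - W f t"
proof -
  have "(\<lambda>s. k s * (h (t - s + a) - f (t - s))) = (\<lambda>s. k s * h (t + a - s) - k s * f (t - s))"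
    by (simp add: algebra_simps)
  then show ?thesis
    unfolding W_def using integral_diff[OF k_integrable[OF assms(2), of "t+a"] k_integrable[OF assms(1), of t]]
    by simp
qed

lemma W_front:
  assumes F: "front f f1 f2"
  shows "f t \<le> W f t" "W f t \<le> W_const * f t" "0 < W f t"
proof -
  have "f s \<le> exp (- m * (t - s)) * f t" if "s \<le> t" for s t
    by (rule harnack(4)[OF frontD(1,2)[OF F] front_bounded[OF F] front_superharmonic[OF F] that])
  then show 1: "f t \<le> W f t" "W f t \<le> W_const * f t"
    using W_bounds[OF front_continuous(1)[OF F]] frontD(4)[OF F] less_imp_le by blast+
  then show "0 < W f t" using frontD(4)[OF F, of t] by simp
qed

text \<open>The kernel ODE splits the convolution into \<beta> times itself and the integral of the
  flux. \<open>k \<tau> = 0\<close> removes the delayed boundary term, and \<open>k 0\<close>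
  completes the coefficients of \<open>f t\<close>.\<close>

lemma W_has_derivative:
  assumes F: "front f f1 f2"
  shows "(W f has_real_derivative \<beta> * W f t + flux \<alpha> f f1 t) (at t)"
proof -
  have "((\<lambda>t. integral {0..\<tau>} (\<lambda>s. k s * f (t - s))) has_real_derivative
      k 0 * f t - k \<tau> * f (t - \<tau>) + integral {0..\<tau>} (\<lambda>s. (\<beta> * k s - p * exp (- \<alpha> * \<tau>) * exp (\<alpha> * s)) * f (t - s))) (at t)"
    by (rule convolution_has_derivative[OF k' _ frontD(1)[OF F]])
       (use \<tau> in \<open>auto intro!: continuous_intros k_continuous front_continuous[OF F]\<close>)
  also have "integral {0..\<tau>} (\<lambda>s. (\<beta> * k s - p * exp (- \<alpha> * \<tau>) * exp (\<alpha> * s)) * f (t - s)) =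
      integral {0..\<tau>} (\<lambda>s. \<beta> * (k s * f (t - s)) - p * exp (- \<alpha> * \<tau>) * (exp (\<alpha> * s) * f (t - s)))"
    by (simp add: algebra_simps)
  also have "\<dots> = \<beta> * integral {0..\<tau>} (\<lambda>s. k s * f (t - s)) -
      p * exp (- \<alpha> * \<tau>) * integral {0..\<tau>} (\<lambda>s. exp (\<alpha> * s) * f (t - s))"
    by (subst integral_diff)
       (auto intro!: integrable_continuous_interval continuous_intros k_continuous
          continuous_on_compose2[OF front_continuous(1)[OF F, of UNIV]])
  finally have "(W f has_real_derivative f1 t + (k 0 * f t - k \<tau> * f (t - \<tau>) + (\<beta> * integral {0..\<tau>} (\<lambda>s. k s * f (t - s)) -
      p * exp (- \<alpha> * \<tau>) * integral {0..\<tau>} (\<lambda>s. exp (\<alpha> * s) * f (t - s))))) (at t)"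
    unfolding W_def by (intro DERIV_add frontD(1)[OF F])
  then show ?thesis
    by (rule back_subst[where P="\<lambda>x. (W f has_real_derivative x) (at t)"])
       (simp add: k\<tau> k0 flux_def W_def algebra_simps)
qed

lemma \<alpha>_le_sup_order:
  assumes F: "front f f1 f2"
  shows "\<alpha> \<le> sup_order f"
  using char_root_le_sup_order[OF F] \<alpha>_least by force

text \<open>As \<open>char \<alpha> = 0\<close>, the weighted flux changes only through the defect,
  of order (1 + \<theta>) \<gamma>, which remains integrable at -infinity after division by
  exp(\<alpha> t).\<close>

lemma scaled_flux_limit:
  assumes F: "front f f1 f2" and \<gamma>: "exp_order f \<gamma>" "\<alpha> < (1 + \<theta>) * \<gamma>"
  shows "\<exists>L K T. \<forall>t\<le>T. \<bar>exp (- \<alpha> * t) * flux \<alpha> f f1 t - L\<bar> \<le> K * exp (((1 + \<theta>) * \<gamma> - \<alpha>) * t)"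
proof -
  obtain T where T: "\<And>t. t \<le> T \<Longrightarrow> \<bar>defect f t\<bar> \<le> C * f t powr (1 + \<theta>)" by (rule defect_bound[OF F]) auto
  from \<gamma>(1) obtain K where K: "\<And>t. t \<le> 0 \<Longrightarrow> f t \<le> K * exp (\<gamma> * t)" by (auto simp: exp_order_def)
  have f: "0 < f t" for t by (rule frontD(4)[OF F])
  have K0: "K > 0" using K[of 0] f[of 0] by simp
  have d: "((\<lambda>t. exp (- \<alpha> * t) * flux \<alpha> f f1 t) has_real_derivative - exp (- \<alpha> * t) * defect f t) (at t)" for t
    by (rule derivative_eq_intros flux_has_derivative[OF F] refl)+ (simp add: algebra_simps char_\<alpha>)
  have b: "\<bar>- exp (- \<alpha> * t) * defect f t\<bar> \<le> (C * K powr (1 + \<theta>)) * exp (((1 + \<theta>) * \<gamma> - \<alpha>) * t)" if "t \<le> min T 0" for t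
  proof -
    have "f t powr (1 + \<theta>) \<le> (K * exp (\<gamma> * t)) powr (1 + \<theta>)"
      using K[of t] f[of t] \<theta> that by (intro powr_mono2) auto
    also have "\<dots> = K powr (1 + \<theta>) * exp ((1 + \<theta>) * \<gamma> * t)"
      using K0 by (simp add: powr_mult exp_powr_real mult_ac)
    finally have "C * f t powr (1 + \<theta>) \<le> C * (K powr (1 + \<theta>) * exp ((1 + \<theta>) * \<gamma> * t))"
      using C by (intro mult_left_mono) auto
    then have "\<bar>defect f t\<bar> \<le> C * (K powr (1 + \<theta>) * exp ((1 + \<theta>) * \<gamma> * t))" using T[of t] that by simp
    then have "exp (- \<alpha> * t) * \<bar>defect f t\<bar> \<le> exp (- \<alpha> * t) * (C * (K powr (1 + \<theta>) * exp ((1 + \<theta>) * \<gamma> * t)))"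
      by (intro mult_left_mono) auto
    also have "\<dots> = (C * K powr (1 + \<theta>)) * (exp (- \<alpha> * t) * exp ((1 + \<theta>) * \<gamma> * t))" by (simp only: ac_simps)
    also have "exp (- \<alpha> * t) * exp ((1 + \<theta>) * \<gamma> * t) = exp (((1 + \<theta>) * \<gamma> - \<alpha>) * t)"
      by (simp add: exp_add [symmetric] algebra_simps)
    finally show ?thesis by (simp add: abs_mult)
  qed
  obtain L where "\<And>t. t \<le> min T 0 \<Longrightarrow> \<bar>exp (- \<alpha> * t) * flux \<alpha> f f1 t - L\<bar>
      \<le> C * K powr (1 + \<theta>) / ((1 + \<theta>) * \<gamma> - \<alpha>) * exp (((1 + \<theta>) * \<gamma> - \<alpha>) * t)"
    using exp_small_derivative_limit[of "min T 0", OF d b] \<gamma>(2) by auto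
  then show ?thesis by blast
qed

lemma tendsto_of_exp_bound:
  fixes h :: "real \<Rightarrow> real"
  assumes "\<And>t. t \<le> T \<Longrightarrow> \<bar>h t - L\<bar> \<le> K * exp (r * t)" "r > 0"
  shows "(h \<longlongrightarrow> L) at_bot"
proof -
  have "((\<lambda>t. K * exp (r * t)) \<longlongrightarrow> 0) at_bot" using assms(2) by real_asymp
  then have "((\<lambda>t. h t - L) \<longlongrightarrow> 0) at_bot"
    by (rule Lim_null_comparison[rotated])
       (use assms(1) in \<open>auto simp: eventually_at_bot_linorder\<close>)
  then show ?thesis by (rule LIM_zero_cancel)
qed

lemma scaled_flux_tendsto:
  assumes F: "front f f1 f2"
  shows "\<exists>L. ((\<lambda>t. exp (- \<alpha> * t) * flux \<alpha> f f1 t) \<longlongrightarrow> L) at_bot"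
proof -
  have "\<alpha> / (1 + \<theta>) < \<alpha>" using \<alpha> \<theta> by (simp add: divide_less_eq)
  then have "\<alpha> / (1 + \<theta>) < sup_order f" using \<alpha>_le_sup_order[OF F] by simp
  then obtain \<gamma> where \<gamma>: "\<alpha> / (1 + \<theta>) < \<gamma>" "\<gamma> < sup_order f" using dense by blast
  then have g: "\<alpha> < (1 + \<theta>) * \<gamma>" using \<theta> by (simp add: divide_less_eq mult.commute)
  from scaled_flux_limit[OF F sup_order(1)[OF F \<gamma>(2)] g] obtain L K T where
    "\<And>t. t \<le> T \<Longrightarrow> \<bar>exp (- \<alpha> * t) * flux \<alpha> f f1 t - L\<bar> \<le> K * exp (((1 + \<theta>) * \<gamma> - \<alpha>) * t)" by blast
  from tendsto_of_exp_bound[OF this] g show ?thesis by auto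
qed

text \<open>If the limit vanishes, the remainder estimate becomes a bound on the flux itself. It is
  restated with the weight of \<beta>, because this is the derivative of \<open>Z\<close>.\<close>

lemma flux_exp_bound:
  assumes F: "front f f1 f2" and lim: "((\<lambda>t. exp (- \<alpha> * t) * flux \<alpha> f f1 t) \<longlongrightarrow> 0) at_bot"
    and \<gamma>: "exp_order f \<gamma>" "\<alpha> < (1 + \<theta>) * \<gamma>"
  shows "\<exists>K T. \<forall>t\<le>T. \<bar>exp (- \<beta> * t) * flux \<alpha> f f1 t\<bar> \<le> K * exp (((1 + \<theta>) * \<gamma> - \<beta>) * t)"
proof -
  obtain L K T where b: "\<And>t. t \<le> T \<Longrightarrow> \<bar>exp (- \<alpha> * t) * flux \<alpha> f f1 t - L\<bar> \<le> K * exp (((1 + \<theta>) * \<gamma> - \<alpha>) * t)"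
    using scaled_flux_limit[OF F \<gamma>] by blast
  have "L = 0"
    using tendsto_unique[OF _ tendsto_of_exp_bound[OF b] lim] \<gamma>(2) by simp
  have "\<bar>exp (- \<beta> * t) * flux \<alpha> f f1 t\<bar> \<le> K * exp (((1 + \<theta>) * \<gamma> - \<beta>) * t)" if "t \<le> T" for t
  proof -
    have "\<bar>exp (- \<beta> * t) * flux \<alpha> f f1 t\<bar> = exp ((\<alpha> - \<beta>) * t) * \<bar>exp (- \<alpha> * t) * flux \<alpha> f f1 t\<bar>"
      by (simp add: abs_mult mult.assoc [symmetric] exp_add [symmetric] algebra_simps)
    also have "\<dots> \<le> exp ((\<alpha> - \<beta>) * t) * (K * exp (((1 + \<theta>) * \<gamma> - \<alpha>) * t))"
      using b[OF that] \<open>L = 0\<close> by (intro mult_left_mono) auto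
    also have "\<dots> = K * (exp ((\<alpha> - \<beta>) * t) * exp (((1 + \<theta>) * \<gamma> - \<alpha>) * t))" by (simp only: ac_simps)
    also have "exp ((\<alpha> - \<beta>) * t) * exp (((1 + \<theta>) * \<gamma> - \<alpha>) * t) = exp (((1 + \<theta>) * \<gamma> - \<beta>) * t)"
      by (simp add: exp_add [symmetric] algebra_simps)
    finally show ?thesis .
  qed
  then show ?thesis by blast
qed

text \<open>This scaling removes the term \<beta> W from the equation of \<open>W\<close>, leaving
  the weighted flux as derivative.\<close>

definition Z :: "(real \<Rightarrow> real) \<Rightarrow> real \<Rightarrow> real" where
  "Z f t = exp (- \<beta> * t) * W f t"

text \<open>The antiderivative of \<open>- exp ((\<alpha> - \<beta>) t)\<close> that tends to infinity at \<open>-\<infinity>\<close>;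
  the first case is the critical speed.\<close>

definition b :: "real \<Rightarrow> real" where
  "b t = (if \<alpha> = \<beta> then - t else exp ((\<alpha> - \<beta>) * t) / (\<beta> - \<alpha>))"

lemma b_has_derivative: "(b has_real_derivative - exp ((\<alpha> - \<beta>) * t)) (at t)"
proof (cases "\<alpha> = \<beta>")
  case True
  then show ?thesis unfolding b_def by (auto intro!: derivative_eq_intros)
next
  case False
  define r where "r = \<alpha> - \<beta>"
  have r: "r \<noteq> 0" and b: "b = (\<lambda>t. exp (r * t) / - r)" using False by (auto simp: r_def b_def)
  have "(b has_real_derivative (exp (r * t) * r) / - r) (at t)"
    unfolding b using r by (auto intro!: derivative_eq_intros)
  also have "(exp (r * t) * r) / - r = - exp (r * t)" using r by simp
  finally show ?thesis by (simp add: r_def)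
qed

lemma b_at_top: "filterlim b at_top at_bot"
proof (cases "\<alpha> = \<beta>")
  case True
  then show ?thesis unfolding b_def by (simp add: filterlim_uminus_at_top_at_bot)
next
  case False
  define r where "r = \<beta> - \<alpha>"
  have r: "r > 0" using False \<alpha>\<beta> by (simp add: r_def)
  then have "filterlim (\<lambda>t. exp (- r * t) / r) at_top at_bot" by real_asymp
  then show ?thesis unfolding b_def using False by (simp add: r_def)
qed

lemma b_pos: "\<forall>\<^sub>F t in at_bot. b t > 0"
  using b_at_top by (simp add: filterlim_at_top_dense)

lemma b_shift: "((\<lambda>t. b (t + a) / b t) \<longlongrightarrow> exp ((\<alpha> - \<beta>) * a)) at_bot"
proof (rule lhopital_at_bot[OF b_at_top])
  show "((\<lambda>t. b (t + a)) has_real_derivative - exp ((\<alpha> - \<beta>) * (t + a))) (at t)" for t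
    by (rule has_deriv_comp_shift[OF b_has_derivative])
  have "- exp ((\<alpha> - \<beta>) * (t + a)) / - exp ((\<alpha> - \<beta>) * t) = exp ((\<alpha> - \<beta>) * a)" for t
    by (simp add: distrib_left exp_add)
  then show "((\<lambda>t. - exp ((\<alpha> - \<beta>) * (t + a)) / - exp ((\<alpha> - \<beta>) * t)) \<longlongrightarrow> exp ((\<alpha> - \<beta>) * a)) at_bot"
    by simp
qed (auto intro: b_has_derivative)

lemma Z_has_derivative:
  assumes F: "front f f1 f2"
  shows "(Z f has_real_derivative exp (- \<beta> * t) * flux \<alpha> f f1 t) (at t)"
  unfolding Z_def
  by (rule derivative_eq_intros W_has_derivative[OF F] refl)+ (simp add: algebra_simps)

lemma Z_pos: "front f f1 f2 \<Longrightarrow> 0 < Z f t"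
  unfolding Z_def using W_front(3) by simp

lemma exp_order_of_Z:
  assumes F: "front f f1 f2" and Zb: "\<And>t. t \<le> T \<Longrightarrow> \<bar>Z f t\<bar> \<le> K * exp ((\<gamma> - \<beta>) * t)"
  shows "exp_order f \<gamma>"
proof (rule exp_orderI[OF F])
  fix t assume t: "t \<le> T"
  have "f t \<le> W f t" by (rule W_front(1)[OF F])
  also have "W f t = exp (\<beta> * t) * Z f t" by (simp add: Z_def mult.assoc [symmetric] exp_add [symmetric])
  also have "\<dots> \<le> exp (\<beta> * t) * (K * exp ((\<gamma> - \<beta>) * t))" using Zb[OF t] by (intro mult_left_mono) auto
  also have "\<dots> = K * (exp (\<beta> * t) * exp ((\<gamma> - \<beta>) * t))" by (simp only: ac_simps)
  also have "exp (\<beta> * t) * exp ((\<gamma> - \<beta>) * t) = exp (\<gamma> * t)" by (simp add: exp_add [symmetric] algebra_simps)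
  finally show "f t \<le> K * exp (\<gamma> * t)" .
qed

text \<open>The limit \<open>L\<close> of the weighted flux decides. If it is nonzero, L'Hopital
  against \<open>b\<close> gives the first alternative. If it is zero, the flux is of higher order
  than the optimal rate \<open>S\<close> of the front; integrating it shows that \<open>Z\<close>
  converges, and a zero limit would improve on \<open>S\<close>.\<close>

theorem Z_asymptotics:
  assumes F: "front f f1 f2"
  shows "(\<exists>A>0. ((\<lambda>t. Z f t / b t) \<longlongrightarrow> A) at_bot) \<or> (\<exists>A>0. (Z f \<longlongrightarrow> A) at_bot)"
proof -
  obtain L where L: "((\<lambda>t. exp (- \<alpha> * t) * flux \<alpha> f f1 t) \<longlongrightarrow> L) at_bot"
    using scaled_flux_tendsto[OF F] by blast
  have lim: "((\<lambda>t. Z f t / b t) \<longlongrightarrow> - L) at_bot"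
  proof (rule lhopital_at_bot[OF b_at_top _ Z_has_derivative[OF F] b_has_derivative])
    have "exp (- \<beta> * t) * flux \<alpha> f f1 t / - exp ((\<alpha> - \<beta>) * t) = - (exp (- \<alpha> * t) * flux \<alpha> f f1 t)" for t
      by (simp add: divide_simps) (simp add: mult.assoc [symmetric] exp_add [symmetric] algebra_simps)
    then show "((\<lambda>t. exp (- \<beta> * t) * flux \<alpha> f f1 t / - exp ((\<alpha> - \<beta>) * t)) \<longlongrightarrow> - L) at_bot"
      using tendsto_minus[OF L] by simp
  qed auto
  show ?thesis
  proof (cases "L = 0")
    case False
    have "0 \<le> - L"
    proof (rule tendsto_lowerbound[OF lim])
      show "\<forall>\<^sub>F t in at_bot. 0 \<le> Z f t / b t"
        using b_pos by eventually_elim (use Z_pos[OF F] in \<open>auto intro: less_imp_le\<close>)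
    qed auto
    with False lim show ?thesis by (intro disjI1 exI[of _ "- L"]) auto
  next
    case True
    define S where "S = sup_order f"
    have S: "\<alpha> \<le> S" unfolding S_def by (rule \<alpha>_le_sup_order[OF F])
    have \<theta>1: "1 + \<theta> > 0" using \<theta> by simp
    have fe: "\<exists>K T. \<forall>t\<le>T. \<bar>exp (- \<beta> * t) * flux \<alpha> f f1 t\<bar> \<le> K * exp (((1 + \<theta>) * \<gamma> - \<beta>) * t)"
      if "\<gamma> < S" "S / (1 + \<theta>) < \<gamma>" for \<gamma>
    proof -
      have "S < (1 + \<theta>) * \<gamma>" using that(2) \<theta>1 by (simp add: divide_less_eq mult.commute)
      then show ?thesis
        using flux_exp_bound[OF F L[unfolded True] sup_order(1)[OF F]] that(1) S by (simp add: S_def)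
    qed
    have S1: "S / (1 + \<theta>) < S" using S \<alpha> \<theta> by (simp add: divide_less_eq)
    have "\<beta> \<le> S"
    proof (rule ccontr)
      assume "\<not> \<beta> \<le> S"
      then have "S / (1 + \<theta>) < \<beta> / (1 + \<theta>)" using \<theta>1 by (simp add: divide_strict_right_mono)
      with S1 have "S / (1 + \<theta>) < min S (\<beta> / (1 + \<theta>))" by simp
      \<comment> \<open>\<gamma> is close enough to \<open>S\<close> for (1 + \<theta>) \<gamma> to
        exceed \<open>S\<close>, yet small enough for the exponent (1 + \<theta>) \<gamma> - \<beta>
        to be negative, so that \<open>exp_large_derivative_bound\<close> applies.\<close>
      then obtain \<gamma> where "S / (1 + \<theta>) < \<gamma>" "\<gamma> < min S (\<beta> / (1 + \<theta>))" using dense by blast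
      then have \<gamma>: "S / (1 + \<theta>) < \<gamma>" "\<gamma> < S" "S < (1 + \<theta>) * \<gamma>" "(1 + \<theta>) * \<gamma> - \<beta> < 0"
        using \<theta>1 by (auto simp: divide_less_eq less_divide_eq mult.commute)
      obtain K T where K: "\<And>t. t \<le> T \<Longrightarrow> \<bar>exp (- \<beta> * t) * flux \<alpha> f f1 t\<bar> \<le> K * exp (((1 + \<theta>) * \<gamma> - \<beta>) * t)"
        using fe[OF \<gamma>(2,1)] by blast
      obtain K' where "\<And>t. t \<le> T \<Longrightarrow> \<bar>Z f t\<bar> \<le> K' * exp (((1 + \<theta>) * \<gamma> - \<beta>) * t)"
        using exp_large_derivative_bound[OF Z_has_derivative[OF F] K \<gamma>(4)] by blast
      then have "exp_order f ((1 + \<theta>) * \<gamma>)" by (rule exp_order_of_Z[OF F])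
      then have "(1 + \<theta>) * \<gamma> \<le> S" unfolding S_def by (rule sup_order(2)[OF F])
      with \<gamma>(3) show False by simp
    qed
    obtain \<gamma> where \<gamma>0: "S / (1 + \<theta>) < \<gamma>" "\<gamma> < S" using dense[OF S1] by blast
    then have \<gamma>: "S < (1 + \<theta>) * \<gamma>" using \<theta>1 by (auto simp: divide_less_eq mult.commute)
    with \<open>\<beta> \<le> S\<close> have pos: "(1 + \<theta>) * \<gamma> - \<beta> > 0" by simp
    obtain K T where K: "\<And>t. t \<le> T \<Longrightarrow> \<bar>exp (- \<beta> * t) * flux \<alpha> f f1 t\<bar> \<le> K * exp (((1 + \<theta>) * \<gamma> - \<beta>) * t)"
      using fe[OF \<gamma>0(2,1)] by blast
    obtain A where A: "\<And>t. t \<le> T \<Longrightarrow> \<bar>Z f t - A\<bar> \<le> K / ((1 + \<theta>) * \<gamma> - \<beta>) * exp (((1 + \<theta>) * \<gamma> - \<beta>) * t)"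
      using exp_small_derivative_limit[OF Z_has_derivative[OF F] K pos] by blast
    have lim: "(Z f \<longlongrightarrow> A) at_bot" by (rule tendsto_of_exp_bound[OF A pos])
    have "A \<ge> 0"
      by (rule tendsto_lowerbound[OF lim]) (use Z_pos[OF F] in \<open>auto intro!: always_eventually intro: less_imp_le\<close>)
    moreover have "A \<noteq> 0"
    proof
      assume "A = 0"
      have "exp_order f ((1 + \<theta>) * \<gamma>)"
        by (rule exp_order_of_Z[OF F A[unfolded \<open>A = 0\<close> diff_0_right]])
      then have "(1 + \<theta>) * \<gamma> \<le> S" unfolding S_def by (rule sup_order(2)[OF F])
      with \<gamma> show False by simp
    qed
    ultimately show ?thesis using lim by (intro disjI2 exI[of _ A]) auto
  qed
qed

end

section \<open>Sliding\<close>

lemma filterlim_shift_at_bot: "filterlim (\<lambda>t. t + a) at_bot (at_bot :: real filter)"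
  unfolding filterlim_at_bot
proof
  fix Z :: real show "\<forall>\<^sub>F t in at_bot. t + a \<le> Z"
    using eventually_le_at_bot[of "Z - a"] by eventually_elim simp
qed

text \<open>Were \<open>D\<close> negative, \<open>d1\<close> would be negative just right of the
  critical point \<open>t\<close>, and \<open>d\<close> would drop below its minimum.\<close>

lemma deriv2_nonneg_at_min:
  fixes d d1 d2 :: "real \<Rightarrow> real"
  assumes d: "\<And>t. (d has_real_derivative d1 t) (at t)" "(d1 has_real_derivative D) (at t)"
    and min: "\<And>s. d t \<le> d s"
  shows "d1 t = 0" "0 \<le> D"
proof -
  show 0: "d1 t = 0" by (rule DERIV_local_min[OF d(1), of 1]) (use min in auto)
  show "0 \<le> D"
  proof (rule ccontr)
    assume "\<not> 0 \<le> D"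
    then obtain e where e: "e > 0" "\<And>h. h > 0 \<Longrightarrow> h < e \<Longrightarrow> d1 (t + h) < d1 t"
      using DERIV_neg_dec_right[OF d(2)] by auto
    obtain z where z: "z > t" "z < t + e / 2" "d (t + e / 2) - d t = (t + e / 2 - t) * d1 z"
      using MVT2[of t "t + e / 2" d d1] d(1) e(1) by auto
    have "d1 z < 0" using e(2)[of "z - t"] z 0 by simp
    then have "e / 2 * d1 z < 0" using e(1) by (intro mult_pos_neg) auto
    then have "d (t + e / 2) < d t" using z(3) by simp
    then show False using min[of "t + e / 2"] by simp
  qed
qed

section \<open>Comparison of two profiles\<close>

context delayed_monostable
begin

text \<open>A maximum principle: a negative minimum of h(t + a) - f(t) would lie right of
  \<open>T\<close>. There the equation bounds it below by the difference of the delayed reactions,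
  which is either nonnegative or, by contraction with q < 1, at least q times the minimum.\<close>

lemma front_le_near_stable_state:
  assumes F: "front f f1 f2" and H: "front h h1 h2"
    and near: "\<And>t. T \<le> t \<Longrightarrow> \<kappa> - \<epsilon> \<le> f t" "\<And>t. T \<le> t \<Longrightarrow> \<kappa> - \<epsilon> \<le> h (t + a)"
    and le: "\<And>t. t \<le> T \<Longrightarrow> f t \<le> h (t + a)"
  shows "f t \<le> h (t + a)"
proof (rule ccontr)
  define d where "d = (\<lambda>t. h (t + a) - f t)"
  define d1 where "d1 = (\<lambda>t. h1 (t + a) - f1 t)"
  define d2 where "d2 = (\<lambda>t. h2 (t + a) - f2 t)"
  have D: "(d has_real_derivative d1 t) (at t)" "(d1 has_real_derivative d2 t) (at t)" for t
    unfolding d_def d1_def d2_def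
    by (intro DERIV_diff has_deriv_comp_shift frontD[OF F] frontD[OF H])+
  assume "\<not> f t \<le> h (t + a)"
  then have dt: "d t < 0" by (simp add: d_def)
  then have tT: "t > T" using le[of t] by (force simp: d_def)
  have "((\<lambda>t. h (t + a) - f t) \<longlongrightarrow> \<kappa> - \<kappa>) at_top"
  proof (intro tendsto_diff frontD(8)[OF F])
    have "filterlim (\<lambda>t. t + a) at_top at_top"
      by (subst add.commute) (rule filterlim_tendsto_add_at_top[OF tendsto_const filterlim_ident])
    then show "((\<lambda>t. h (t + a)) \<longlongrightarrow> \<kappa>) at_top" by (rule filterlim_compose[OF frontD(8)[OF H]])
  qed
  \<comment> \<open>The difference tends to 0 at +infinity and is nonnegative left of
    \<open>T\<close>, so its infimum is attained on a compact interval.\<close>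
  then have "\<forall>\<^sub>F s in at_top. d t < d s"
    using dt unfolding d_def by (intro order_tendstoD(1)) auto
  then obtain T1 where T1: "\<And>s. T1 \<le> s \<Longrightarrow> d t < d s" by (auto simp: eventually_at_top_linorder)
  have T1t: "t < T1" using T1[of t] by force
  have "continuous_on {T..T1} d"
    by (rule DERIV_continuous_on[OF has_field_derivative_at_within[OF D(1)]])
  then obtain t1 where t1: "t1 \<in> {T..T1}" "\<And>s. s \<in> {T..T1} \<Longrightarrow> d t1 \<le> d s"
    using continuous_attains_inf[of "{T..T1}" d] tT T1t by auto
  have t1t: "d t1 \<le> d t" using t1(2)[of t] tT T1t by auto
  have min: "d t1 \<le> d s" for s
  proof -
    consider "s \<le> T" | "s \<in> {T..T1}" | "T1 \<le> s" by fastforce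
    then show ?thesis
      using le[of s] t1(2)[of s] T1[of s] t1t dt by cases (auto simp: d_def)
  qed
  have "d1 t1 = 0" "0 \<le> d2 t1" by (rule deriv2_nonneg_at_min[OF D(1) D(2) min])+
  then have *: "d t1 \<ge> g (h (t1 + a - \<tau>)) - g (f (t1 - \<tau>))"
    using frontD(3)[OF F, of t1] frontD(3)[OF H, of "t1 + a"] by (simp add: d_def d1_def d2_def)
  show False
  proof (cases "0 \<le> d (t1 - \<tau>)")
    case True
    then have "g (f (t1 - \<tau>)) \<le> g (h (t1 + a - \<tau>))"
      using frontD(4)[OF F, of "t1 - \<tau>"] by (intro g_mono) (auto simp: d_def algebra_simps)
    with * t1t dt show False by simp
  next
    case False
    then have "t1 - \<tau> > T" using le[of "t1 - \<tau>"] by (force simp: d_def)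
    then have "g (f (t1 - \<tau>)) - g (h (t1 - \<tau> + a)) \<le> q * (f (t1 - \<tau>) - h (t1 - \<tau> + a))"
      using near[of "t1 - \<tau>"] frontD(5)[OF F, of "t1 - \<tau>"] False by (intro g_contr) (auto simp: d_def)
    then have "d t1 \<ge> q * d (t1 - \<tau>)" using * by (simp add: d_def algebra_simps)
    moreover have "q * d (t1 - \<tau>) \<ge> q * d t1" using min q by (intro mult_left_mono) auto
    moreover have "q * d t1 > d t1" using q t1t dt by (simp add: mult_less_cancel_right1)
    ultimately show False by simp
  qed
qed

text \<open>Monotonicity of \<open>g\<close> makes the delayed term of the difference nonnegative,
  so the difference is a supersolution.\<close>

lemma front_diff_harnack:
  assumes F: "front f f1 f2" and H: "front h h1 h2" and le: "\<And>t. f t \<le> h (t + a)"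
  shows "s \<le> t \<Longrightarrow> h (s + a) - f s \<le> exp (- m * (t - s)) * (h (t + a) - f t)"
    and "f s < h (s + a) \<Longrightarrow> f t < h (t + a)"
proof -
  define d where "d = (\<lambda>t. h (t + a) - f t)"
  define d1 where "d1 = (\<lambda>t. h1 (t + a) - f1 t)"
  define d2 where "d2 = (\<lambda>t. h2 (t + a) - f2 t)"
  have D: "(d has_real_derivative d1 t) (at t)" "(d1 has_real_derivative d2 t) (at t)" for t
    unfolding d_def d1_def d2_def
    by (intro DERIV_diff has_deriv_comp_shift frontD[OF F] frontD[OF H])+
  have B: "\<bar>d t\<bar> \<le> \<kappa>" for t
    using frontD(4,5)[OF F, of t] frontD(4,5)[OF H, of "t + a"] le[of t] by (simp add: d_def)
  have ineq: "d2 t - c * d1 t - d t \<le> 0" for t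
  proof -
    have "g (f (t - \<tau>)) \<le> g (h (t + a - \<tau>))"
      using frontD(4)[OF F, of "t - \<tau>"] le[of "t - \<tau>"] by (intro g_mono) (auto simp: algebra_simps)
    then show ?thesis
      using frontD(3)[OF F, of t] frontD(3)[OF H, of "t + a"] by (simp add: d_def d1_def d2_def algebra_simps)
  qed
  show "s \<le> t \<Longrightarrow> h (s + a) - f s \<le> exp (- m * (t - s)) * (h (t + a) - f t)"
    using harnack(4)[OF D B ineq] by (simp add: d_def)
  show "f s < h (s + a) \<Longrightarrow> f t < h (t + a)"
    using harnack(5)[OF D B ineq] by (simp add: d_def)
qed

end

section \<open>Sliding one profile along the other\<close>

context monostable_roots
begin

text \<open>The factor \<open>W_const\<close> pays for passing from averaged to pointwise order near
  -infinity. A larger shift handles the bounded middle range, and the maximum principle the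
  rest.\<close>

lemma sliding_start:
  assumes F: "front f f1 f2" and H: "front h h1 h2"
    and dom: "\<forall>\<^sub>F t in at_bot. W_const * W f t \<le> W h (t + a)"
  shows "\<exists>a'\<ge>a. \<forall>t. f t \<le> h (t + a')"
proof -
  obtain T where T: "\<And>t. t \<le> T \<Longrightarrow> W_const * W f t \<le> W h (t + a)"
    using dom by (auto simp: eventually_at_bot_linorder)
  have left: "f t \<le> h (t + a)" if "t \<le> T" for t
  proof -
    have "W_const * f t \<le> W_const * W f t" using W_front(1)[OF F] W_const by (intro mult_left_mono) auto
    also have "\<dots> \<le> W_const * h (t + a)" using T[OF that] W_front(2)[OF H, of "t + a"] by linarith
    finally show ?thesis using W_const by simp
  qed
  have "\<forall>\<^sub>F t in at_top. \<kappa> - \<epsilon> < f t" "\<forall>\<^sub>F t in at_top. \<kappa> - \<epsilon> < h t"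
    using \<epsilon> by (intro order_tendstoD(1)[OF frontD(8)[OF F]] order_tendstoD(1)[OF frontD(8)[OF H]]; simp)+
  then obtain U V where U: "\<And>t. t \<ge> U \<Longrightarrow> \<kappa> - \<epsilon> < f t" and V: "\<And>t. t \<ge> V \<Longrightarrow> \<kappa> - \<epsilon> < h t"
    by (auto simp: eventually_at_top_linorder)
  define T' where "T' = max T (max U (V - a))"
  have "\<forall>\<^sub>F t in at_top. f T' < h t"
    using front_less[OF F] by (intro order_tendstoD(1)[OF frontD(8)[OF H]])
  then obtain X where X: "\<And>t. t \<ge> X \<Longrightarrow> f T' < h t" by (auto simp: eventually_at_top_linorder)
  \<comment> \<open>With this shift, t > T implies t + a' \<ge> X.\<close>
  define a' where "a' = max a (X - T)"
  have "f t \<le> h (t + a')" for t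
  proof (rule front_le_near_stable_state[OF F H, where T=T'])
    fix t assume t: "t \<le> T'"
    show "f t \<le> h (t + a')"
    proof (cases "t \<le> T")
      case True
      have "f t \<le> h (t + a)" by (rule left[OF True])
      also have "\<dots> \<le> h (t + a')" by (rule front_le[OF H]) (simp add: a'_def)
      finally show ?thesis .
    next
      case False
      have "f t \<le> f T'" by (rule front_le[OF F t])
      also have "\<dots> < h (t + a')" using False by (intro X) (auto simp: a'_def)
      finally show ?thesis by simp
    qed
  qed (use U V in \<open>auto simp: T'_def a'_def intro!: less_imp_le\<close>)
  moreover have "a \<le> a'" by (simp add: a'_def)
  ultimately show ?thesis by blast
qed

text \<open>The order holds with room to spare: by a factor left of \<open>T\<close>, by a constant
  on the middle interval. A shift by \<open>e\<close> costs at most the factor exp(l e) by Harnack,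
  so a small \<open>e\<close> fits into both margins.\<close>

lemma sliding_step:
  assumes F: "front f f1 f2" and H: "front h h1 h2" and M: "M > 1"
    and dom: "\<forall>\<^sub>F t in at_bot. M * W f t \<le> W h (t + a)"
    and le: "\<And>t. f t \<le> h (t + a)"
  shows "\<exists>e>0. \<forall>a'\<ge>a-e. \<forall>t. f t \<le> h (t + a')"
proof -
  define d where "d = (\<lambda>t. h (t + a) - f t)"
  have d0: "0 \<le> d t" for t using le[of t] by (simp add: d_def)
  have dc: "continuous_on UNIV d"
    unfolding d_def
    by (intro continuous_intros front_continuous(1)[OF F] continuous_on_compose2[OF front_continuous(1)[OF H, of UNIV]]) auto
  obtain T where T: "\<And>t. t \<le> T \<Longrightarrow> M * W f t \<le> W h (t + a)"
    using dom by (auto simp: eventually_at_bot_linorder)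
  \<comment> \<open>From (M - 1) f \<le> (M - 1) W f \<le> W d \<le> W_const d, one reads off d
    \<ge> \<eta> f.\<close>
  define \<eta> where "\<eta> = (M - 1) / W_const"
  have \<eta>: "\<eta> > 0" using M W_const by (simp add: \<eta>_def)
  have left: "(1 + \<eta>) * f t \<le> h (t + a)" if "t \<le> T" for t
  proof -
    have "(M - 1) * f t \<le> (M - 1) * W f t" using W_front(1)[OF F] M by (intro mult_left_mono) auto
    also have "\<dots> \<le> W h (t + a) - W f t" using T[OF that] by (simp add: algebra_simps)
    also have "\<dots> = W d t"
      unfolding d_def by (rule W_diff[symmetric]) (rule front_continuous[OF F] front_continuous[OF H])+
    also have "\<dots> \<le> W_const * d t"
      by (rule W_bounds(2)[OF dc d0]) (unfold d_def, rule front_diff_harnack(1)[OF F H le])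
    finally show ?thesis using W_const by (simp add: \<eta>_def d_def field_simps)
  qed
  have "\<forall>\<^sub>F t in at_top. \<kappa> - \<epsilon> < f t" "\<forall>\<^sub>F t in at_top. \<kappa> - \<epsilon> < h t"
    using \<epsilon> by (intro order_tendstoD(1)[OF frontD(8)[OF F]] order_tendstoD(1)[OF frontD(8)[OF H]]; simp)+
  then obtain U V where U: "\<And>t. t \<ge> U \<Longrightarrow> \<kappa> - \<epsilon> < f t" and V: "\<And>t. t \<ge> V \<Longrightarrow> \<kappa> - \<epsilon> < h t"
    by (auto simp: eventually_at_top_linorder)
  \<comment> \<open>The additional 1 keeps \<open>h\<close> near \<kappa> after the shift has
    decreased by \<open>e < 1\<close>.\<close>
  define T' where "T' = max T (max U (V - a + 1))"
  have dT: "d T > 0" 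
  proof -
    have "\<eta> * f T > 0" using \<eta> frontD(4)[OF F, of T] by simp
    then show ?thesis using left[of T] by (simp add: d_def algebra_simps)
  qed
  \<comment> \<open>The least value that Harnack leaves for \<open>d\<close> between
    \<open>T\<close> and \<open>T'\<close>, starting from \<open>d T\<close>.\<close>
  define r where "r = exp (m * (T' - T)) * d T"
  have r: "r > 0" using dT by (simp add: r_def)
  have mid: "r \<le> d t" if "T \<le> t" "t \<le> T'" for t
  proof -
    have "d T \<le> exp (- m * (t - T)) * d t"
      unfolding d_def by (rule front_diff_harnack(1)[OF F H le that(1)])
    also have "\<dots> \<le> exp (- m * (T' - T)) * d t"
      using that m d0 by (intro mult_right_mono) (auto simp: mult_left_mono_neg)
    finally have "exp (m * (T' - T)) * d T \<le> exp (m * (T' - T)) * (exp (- m * (T' - T)) * d t)"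
      by (intro mult_left_mono) auto
    also have "\<dots> = d t" by (simp add: mult.assoc [symmetric] exp_add [symmetric])
    finally show ?thesis by (simp add: r_def)
  qed
  have "((\<lambda>e. exp (l * e)) \<longlongrightarrow> exp (l * 0)) (at_right 0)" by (intro tendsto_intros)
  then have "\<forall>\<^sub>F e in at_right 0. exp (l * e) < min (1 + \<eta>) (1 + r / \<kappa>)"
    using \<eta> r \<kappa> by (intro order_tendstoD(2)) auto
  moreover have "\<forall>\<^sub>F e in at_right (0::real). e \<in> {0<..<1}" by (intro eventually_at_right_real) auto
  ultimately have "\<forall>\<^sub>F e in at_right 0. exp (l * e) < min (1 + \<eta>) (1 + r / \<kappa>) \<and> e \<in> {0<..<1}"
    by eventually_elim auto
  then obtain e where e: "exp (l * e) < 1 + \<eta>" "exp (l * e) < 1 + r / \<kappa>" "0 < e" "e < 1"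
    using eventually_happens'[OF trivial_limit_at_right_real] by fastforce
  have slow: "h (t + a) \<le> exp (l * e) * h (t + (a - e))" for t
    using front_harnack(2)[OF H, of "t + (a - e)" "t + a"] e by simp
  have shift: "f t \<le> h (t + (a - e))" for t
  proof (rule front_le_near_stable_state[OF F H, where T=T'])
    fix t assume t: "t \<le> T'"
    show "f t \<le> h (t + (a - e))"
    proof (cases "t \<le> T")
      case True
      have "exp (l * e) * f t \<le> (1 + \<eta>) * f t" using e frontD(4)[OF F, of t] by (intro mult_right_mono) auto
      also have "\<dots> \<le> exp (l * e) * h (t + (a - e))" using left[OF True] slow[of t] by linarith
      finally show ?thesis by simp
    next
      case False
      have "f t + r \<le> h (t + a)" using mid[of t] False t by (simp add: d_def)
      also have "\<dots> \<le> exp (l * e) * h (t + (a - e))" by (rule slow)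
      also have "\<dots> = h (t + (a - e)) + (exp (l * e) - 1) * h (t + (a - e))" by (simp add: algebra_simps)
      \<comment> \<open>Since h \<le> \<kappa>, the loss caused by the shift is at most
        \<open>r\<close>.\<close>
      also have "(exp (l * e) - 1) * h (t + (a - e)) \<le> r / \<kappa> * \<kappa>"
        using e l frontD(4,5)[OF H, of "t + (a - e)"] r \<kappa> by (intro mult_mono) auto
      finally show ?thesis using \<kappa> by simp
    qed
  qed (use U V e in \<open>auto simp: T'_def intro!: less_imp_le\<close>)
  show ?thesis
  proof (intro exI[of _ e] conjI allI impI)
    fix a' t assume "a - e \<le> a'"
    then have "h (t + (a - e)) \<le> h (t + a')" by (intro front_le[OF H]) auto
    with shift[of t] show "f t \<le> h (t + a')" by simp
  qed (use e in auto)
qed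

text \<open>A continuity argument: the set of admissible shifts above \<open>a1\<close> is nonempty
  by \<open>sliding_start\<close> and closed, and \<open>sliding_step\<close> moves below its
  infimum unless that is \<open>a1\<close>.\<close>

lemma sliding:
  assumes F: "front f f1 f2" and H: "front h h1 h2"
    and big: "\<And>M. \<exists>a. \<forall>\<^sub>F t in at_bot. M * W f t \<le> W h (t + a)"
    and dom: "\<And>a. a > a0 \<Longrightarrow> \<exists>M>1. \<forall>\<^sub>F t in at_bot. M * W f t \<le> W h (t + a)"
    and a1: "a1 > a0"
  shows "f t \<le> h (t + a1)"
proof -
  define A where "A = {a. a1 \<le> a \<and> (\<forall>t. f t \<le> h (t + a))}"
  obtain a where "\<forall>\<^sub>F t in at_bot. W_const * W f t \<le> W h (t + a)" using big by blast
  then obtain a' where a': "\<And>t. f t \<le> h (t + a')" using sliding_start[OF F H] by blast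
  have "f t \<le> h (t + max a1 a')" for t
    using a'[of t] front_le[OF H, of "t + a'" "t + max a1 a'"] by simp
  then have ne: "A \<noteq> {}" by (auto simp: A_def intro!: exI[of _ "max a1 a'"])
  have bdd: "bdd_below A" by (auto simp: A_def intro!: bdd_belowI[of _ a1])
  have "closed A"
  proof -
    have "closed {a. f t \<le> h (t + a)}" for t
      by (intro closed_Collect_le continuous_intros continuous_on_compose2[OF front_continuous(1)[OF H, of UNIV]]) auto
    then have "closed ({a1..} \<inter> (\<Inter>t. {a. f t \<le> h (t + a)}))" by (intro closed_Int closed_INT) auto
    moreover have "A = {a1..} \<inter> (\<Inter>t. {a. f t \<le> h (t + a)})" by (auto simp: A_def)
    ultimately show ?thesis by simp
  qed
  then have inf: "Inf A \<in> A" by (rule closed_contains_Inf[OF ne bdd])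
  have "Inf A = a1"
  proof (rule ccontr)
    assume "Inf A \<noteq> a1"
    then have gt: "Inf A > a1" using inf by (auto simp: A_def)
    obtain M where M: "M > 1" "\<forall>\<^sub>F t in at_bot. M * W f t \<le> W h (t + Inf A)"
      using dom[of "Inf A"] gt a1 by auto
    have "f t \<le> h (t + Inf A)" for t using inf by (auto simp: A_def)
    from sliding_step[OF F H M this] obtain e where
      e: "e > 0" "\<And>a t. a \<ge> Inf A - e \<Longrightarrow> f t \<le> h (t + a)" by blast
    have "max a1 (Inf A - e) \<in> A" using e by (auto simp: A_def)
    then have "Inf A \<le> max a1 (Inf A - e)" by (rule cInf_lower[OF _ bdd])
    then show False using gt e(1) by simp
  qed
  with inf show ?thesis by (auto simp: A_def)
qed

lemma eventually_dom_of_ratio: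
  assumes F: "front f f1 f2" and "\<forall>\<^sub>F t in at_bot. M < W h (t + a) / W f t"
  shows "\<forall>\<^sub>F t in at_bot. M * W f t \<le> W h (t + a)"
  using assms(2) by eventually_elim (use W_front(3)[OF F] in \<open>simp add: less_divide_eq less_imp_le\<close>)

text \<open>The limiting ratio exceeds 1 exactly for shifts above
  \<open>- ln R / \<Lambda>\<close>.\<close>

lemma front_le_of_ratio:
  assumes F: "front f f1 f2" and H: "front h h1 h2" and R: "R > 0" and \<Lambda>: "\<Lambda> > 0"
    and lim: "\<And>a. ((\<lambda>t. W h (t + a) / W f t) \<longlongrightarrow> R * exp (\<Lambda> * a)) at_bot"
  shows "f t \<le> h (t - ln R / \<Lambda>)"
proof -
  define a0 where "a0 = - ln R / \<Lambda>"
  have le: "f t \<le> h (t + a)" if "a > a0" for a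
  proof (rule sliding[OF F H _ _ that])
    fix M :: real
    have "filterlim (\<lambda>a. R * exp (\<Lambda> * a)) at_top at_top" using R \<Lambda> by real_asymp
    then have "\<forall>\<^sub>F a in at_top. M < R * exp (\<Lambda> * a)" by (simp add: filterlim_at_top_dense)
    then obtain a where "M < R * exp (\<Lambda> * a)"
      using eventually_happens'[OF trivial_limit_at_top_linorder] by blast
    then show "\<exists>a. \<forall>\<^sub>F t in at_bot. M * W f t \<le> W h (t + a)"
      using eventually_dom_of_ratio[OF F order_tendstoD(1)[OF lim]] by blast
  next
    fix a assume "a > a0"
    then have "- ln R < a * \<Lambda>" unfolding a0_def using \<Lambda> by (simp only: divide_less_eq if_True)
    then have "0 < ln R + \<Lambda> * a" by (simp add: mult.commute)
    then have "exp 0 < exp (ln R + \<Lambda> * a)" by (subst exp_less_cancel_iff)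
    then have "1 < R * exp (\<Lambda> * a)" using R by (simp add: exp_add)
    then obtain M where "1 < M" "M < R * exp (\<Lambda> * a)" using dense by blast
    then show "\<exists>M>1. \<forall>\<^sub>F t in at_bot. M * W f t \<le> W h (t + a)"
      using eventually_dom_of_ratio[OF F order_tendstoD(1)[OF lim]] by blast
  qed
  \<comment> \<open>The critical shift itself, where the ratio tends to 1, is reached by continuity
    of \<open>h\<close>.\<close>
  have "isCont h (t + a0)" using frontD(1)[OF H] by (rule DERIV_isCont)
  moreover have "((\<lambda>a. t + a) \<longlongrightarrow> t + a0) (at_right a0)" by (intro tendsto_intros)
  ultimately have "((\<lambda>a. h (t + a)) \<longlongrightarrow> h (t + a0)) (at_right a0)" by (rule isCont_tendsto_compose)
  then have "f t \<le> h (t + a0)"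
    by (rule tendsto_lowerbound) (use le in \<open>auto simp: eventually_at_filter\<close>)
  then show ?thesis by (simp add: a0_def)
qed

text \<open>The scale \<open>s\<close> is the common asymptotic reference, either \<open>b\<close>
  or 1. The ratio factors through it, and translation contributes exp(\<beta> a) from
  \<open>Z\<close> and exp(\<omega> a) from \<open>s\<close>.\<close>

lemma W_ratio_tendsto:
  assumes F: "front f f1 f2"
    and s: "\<forall>\<^sub>F t in at_bot. 0 < s t" "((\<lambda>t. s (t + a) / s t) \<longlongrightarrow> exp (\<omega> * a)) at_bot"
    and lim: "((\<lambda>t. Z f t / s t) \<longlongrightarrow> A) at_bot" "((\<lambda>t. Z h t / s t) \<longlongrightarrow> B) at_bot" and A: "A > 0"
  shows "((\<lambda>t. W h (t + a) / W f t) \<longlongrightarrow> B / A * exp ((\<beta> + \<omega>) * a)) at_bot"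
proof -
  have "((\<lambda>t. Z h (t + a) / s (t + a)) \<longlongrightarrow> B) at_bot"
    by (rule filterlim_compose[OF lim(2) filterlim_shift_at_bot])
  then have "((\<lambda>t. exp (\<beta> * a) * (Z h (t + a) / s (t + a) * (s (t + a) / s t) / (Z f t / s t))) \<longlongrightarrow>
      exp (\<beta> * a) * (B * exp (\<omega> * a) / A)) at_bot"
    using A by (intro tendsto_intros lim s) auto
  also have "exp (\<beta> * a) * (B * exp (\<omega> * a) / A) = B / A * exp ((\<beta> + \<omega>) * a)"
    by (simp add: exp_add distrib_right)
  finally show ?thesis
  proof (rule Lim_transform_eventually)
    have "\<forall>\<^sub>F t in at_bot. 0 < s (t + a)"
      using filterlim_shift_at_bot s(1) by (rule eventually_compose_filterlim[rotated])
    with s(1) show "\<forall>\<^sub>F t in at_bot. exp (\<beta> * a) * (Z h (t + a) / s (t + a) * (s (t + a) / s t) / (Z f t / s t)) =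
        W h (t + a) / W f t"
    proof eventually_elim
      case (elim t)
      have "exp (\<beta> * a) * (Z h (t + a) / s (t + a) * (s (t + a) / s t) / (Z f t / s t)) =
          exp (\<beta> * a) * Z h (t + a) / Z f t"
        using elim by simp
      also have "exp (\<beta> * a) * Z h (t + a) = exp (- \<beta> * t) * W h (t + a)"
        by (simp add: Z_def mult.assoc [symmetric] exp_add [symmetric] algebra_simps)
      also have "\<dots> / Z f t = W h (t + a) / W f t" by (simp add: Z_def)
      finally show ?case .
    qed
  qed
qed

text \<open>Exchanging the fronts inverts the limiting ratio, so the two critical shifts are
  opposite and the two inequalities concern the same translate.\<close>

lemma fronts_equal_of_same_asymptotics:
  assumes F: "front f f1 f2" and H: "front h h1 h2"
    and s: "\<forall>\<^sub>F t in at_bot. 0 < s t" "\<And>a. ((\<lambda>t. s (t + a) / s t) \<longlongrightarrow> exp (\<omega> * a)) at_bot"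
    and lim: "((\<lambda>t. Z f t / s t) \<longlongrightarrow> A) at_bot" "((\<lambda>t. Z h t / s t) \<longlongrightarrow> B) at_bot"
    and A: "A > 0" and B: "B > 0" and \<omega>: "\<beta> + \<omega> > 0"
  shows "\<exists>a. \<forall>t. f t = h (t + a)"
proof -
  define a where "a = ln (B / A) / (\<beta> + \<omega>)"
  have 1: "f t \<le> h (t - a)" for t
    unfolding a_def
    by (rule front_le_of_ratio[OF F H _ \<omega> W_ratio_tendsto[OF F s lim A]]) (use A B in simp)
  have 2: "h t \<le> f (t - ln (A / B) / (\<beta> + \<omega>))" for t
    by (rule front_le_of_ratio[OF H F _ \<omega> W_ratio_tendsto[OF H s lim(2,1) B]]) (use A B in simp)
  have "ln (A / B) = - ln (B / A)" using A B by (simp add: ln_div)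
  then have "h (t - a) \<le> f t" for t using 2[of "t - a"] by (simp add: a_def)
  with 1 have "\<forall>t. f t = h (t + (- a))" by (simp add: order_antisym)
  then show ?thesis by blast
qed

text \<open>\<open>Z h\<close> diverges while \<open>Z f\<close> stays bounded, so every translate
  of \<open>h\<close> dominates near -infinity and sliding never stops.\<close>

lemma fronts_not_differently_asymptotic:
  assumes F: "front f f1 f2" and H: "front h h1 h2"
    and lim: "(Z f \<longlongrightarrow> A) at_bot" "((\<lambda>t. Z h t / b t) \<longlongrightarrow> B) at_bot" and A: "A > 0" and B: "B > 0"
  shows False
proof -
  have dom: "\<forall>\<^sub>F t in at_bot. M * W f t \<le> W h (t + a)" for M a
  proof (rule eventually_dom_of_ratio[OF F])
    have "filterlim (\<lambda>t. Z h t / b t * b t) at_top at_bot"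
      by (rule filterlim_tendsto_pos_mult_at_top[OF lim(2) B b_at_top])
    then have Zh: "filterlim (Z h) at_top at_bot"
      by (rule filterlim_mono_eventually[OF _ order_refl order_refl])
         (use b_pos in \<open>eventually_elim, simp\<close>)
    have "filterlim (\<lambda>t. exp (\<beta> * a) / Z f t * Z h (t + a)) at_top at_bot"
      by (rule filterlim_tendsto_pos_mult_at_top[of _ "exp (\<beta> * a) / A"])
         (use A in \<open>auto intro!: tendsto_intros lim filterlim_compose[OF Zh filterlim_shift_at_bot]\<close>)
    then have "\<forall>\<^sub>F t in at_bot. M < exp (\<beta> * a) / Z f t * Z h (t + a)"
      by (simp add: filterlim_at_top_dense)
    then show "\<forall>\<^sub>F t in at_bot. M < W h (t + a) / W f t"
    proof eventually_elim
      case (elim t)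
      have "exp (\<beta> * a) * Z h (t + a) = exp (- \<beta> * t) * W h (t + a)"
        by (simp add: Z_def mult.assoc [symmetric] exp_add [symmetric] algebra_simps)
      then have "exp (\<beta> * a) * Z h (t + a) / Z f t = W h (t + a) / W f t" by (simp only:) (simp add: Z_def)
      with elim show ?case by simp
    qed
  qed
  have le: "f 0 \<le> h (0 + a)" for a
  proof (rule sliding[OF F H, where ?a0.0="a - 1"])
    show "\<exists>M>1. \<forall>\<^sub>F t in at_bot. M * W f t \<le> W h (t + a)" for a
      using dom[of 2 a] by (intro exI[of _ 2]) auto
  qed (use dom in auto)
  \<comment> \<open>Let the shift tend to -infinity.\<close>
  have "f 0 \<le> 0"
    by (rule tendsto_lowerbound[OF frontD(7)[OF H]]) (use le in auto)
  then show False using frontD(4)[OF F, of 0] by simp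
qed

theorem fronts_equal_up_to_shift:
  assumes F: "front f f1 f2" and H: "front h h1 h2"
  shows "\<exists>a. \<forall>t. f t = h (t + a)"
proof -
  have "\<beta> > 0" using \<alpha> \<alpha>\<beta> by simp
  consider A B where "A > 0" "B > 0" "((\<lambda>t. Z f t / b t) \<longlongrightarrow> A) at_bot" "((\<lambda>t. Z h t / b t) \<longlongrightarrow> B) at_bot"
    | A B where "A > 0" "B > 0" "(Z f \<longlongrightarrow> A) at_bot" "(Z h \<longlongrightarrow> B) at_bot"
    | A B where "A > 0" "B > 0" "(Z f \<longlongrightarrow> A) at_bot" "((\<lambda>t. Z h t / b t) \<longlongrightarrow> B) at_bot"
    | A B where "A > 0" "B > 0" "((\<lambda>t. Z f t / b t) \<longlongrightarrow> A) at_bot" "(Z h \<longlongrightarrow> B) at_bot"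
    using Z_asymptotics[OF F] Z_asymptotics[OF H] by blast
  then show ?thesis
  proof cases
    case 1
    \<comment> \<open>Here \<omega> = \<alpha> - \<beta>, so the translation exponent is
      \<alpha>.\<close>
    show ?thesis by (rule fronts_equal_of_same_asymptotics[OF F H b_pos b_shift 1(3,4,1,2)]) (use \<alpha> in simp)
  next
    case 2
    show ?thesis
      by (rule fronts_equal_of_same_asymptotics[OF F H, where s="\<lambda>_. 1" and \<omega>=0 and A=A and B=B])
         (use 2 \<open>\<beta> > 0\<close> in auto)
  next
    case 3
    then show ?thesis using fronts_not_differently_asymptotic[OF F H] by blast
  next
    case 4
    then show ?thesis using fronts_not_differently_asymptotic[OF H F] by blast
  qed
qed

end

section \<open>Uniqueness, and passage from the original hypotheses\<close>

theorem (in delayed_monostable) front_unique: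
  assumes F: "front f f1 f2" and H: "front h h1 h2"
  shows "\<exists>a. \<forall>t. f t = h (t + a)"
proof -
  have "\<exists>z. 0 \<le> z \<and> z \<le> l \<and> char z = 0"
    using char_root_le_sup_order[OF F] sup_order(4)[OF F] by force
  then obtain \<alpha> \<beta> k where "monostable_roots g \<kappa> \<tau> c p l m C \<theta> \<delta> \<epsilon> q \<alpha> \<beta> k"
    using monostable_roots_exist by blast
  then show ?thesis by (rule monostable_roots.fronts_equal_up_to_shift[OF _ F H])
qed

theorem theorem2:
  fixes g :: "real \<Rightarrow> real" and \<kappa> h c :: real and \<phi> \<psi> :: "real \<Rightarrow> real"
  assumes "h > 0" and "hypH g \<kappa>" and "c > 0"
    and "traveling_front g \<kappa> h c \<phi>" and "traveling_front g \<kappa> h c \<psi>"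
  shows "\<exists>s0. \<forall>s. \<phi> s = \<psi> (s + s0)"
proof -
  note H = assms(2)[unfolded hypH_def, THEN conjunct2]
  note H' = H[THEN conjunct2, THEN conjunct2]
  have g: "strict_mono_on {0..} g" by (rule H[THEN conjunct1])
  have g0: "\<And>x. 0 \<le> x \<Longrightarrow> 0 \<le> g x" using H[THEN conjunct2, THEN conjunct1] by blast
  have \<kappa>0: "\<kappa> > 0" by (rule H'[THEN conjunct1])
  have "\<kappa> \<in> {x. x \<ge> 0 \<and> g x = x}" unfolding H'[THEN conjunct2, THEN conjunct1] by simp
  then have \<kappa>: "\<kappa> > 0" "g \<kappa> = \<kappa>" using \<kappa>0 by auto
  obtain p d\<kappa> C \<theta> \<delta> where p: "p > 1" and d\<kappa>: "(g has_real_derivative d\<kappa>) (at \<kappa> within {0..})" "d\<kappa> < 1"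
    and C: "C > 0" "\<theta> > 0" "\<delta> > 0" "\<And>u. 0 < u \<Longrightarrow> u \<le> \<delta> \<Longrightarrow> \<bar>g u / u - p\<bar> \<le> C * u powr \<theta>"
    using H'[THEN conjunct2, THEN conjunct2, THEN conjunct1] by blast
  obtain \<epsilon>0 g' where e0: "\<epsilon>0 > 0"
    and g': "\<And>x. x \<in> {\<kappa>-\<epsilon>0<..<\<kappa>+\<epsilon>0} \<Longrightarrow> (g has_real_derivative g' x) (at x)"
    and g'c: "continuous_on {\<kappa>-\<epsilon>0<..<\<kappa>+\<epsilon>0} g'"
    using H'[THEN conjunct2, THEN conjunct2, THEN conjunct2] by blast
  have "at \<kappa> within {0..} = at \<kappa>" using \<kappa> by (intro at_within_interior) auto
  then have "g' \<kappa> = d\<kappa>" using d\<kappa>(1) g'[of \<kappa>] e0 by (auto intro: DERIV_unique)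
  have "isCont g' \<kappa>" using continuous_on_interior[OF g'c, of \<kappa>] e0 by simp
  then have "g' \<midarrow>\<kappa>\<rightarrow> d\<kappa>" using \<open>g' \<kappa> = d\<kappa>\<close> by (simp add: isCont_def)
  \<comment> \<open>The midpoint between g'(\<kappa>) and 1, cut off at 0 to be a nonnegative
    contraction factor.\<close>
  define q where "q = max 0 ((1 + d\<kappa>) / 2)"
  have q: "0 \<le> q" "q < 1" "d\<kappa> < q" using d\<kappa>(2) by (auto simp: q_def less_max_iff_disj field_simps)
  have "\<forall>\<^sub>F x in at \<kappa>. g' x < q" by (rule order_tendstoD(2)[OF \<open>g' \<midarrow>\<kappa>\<rightarrow> d\<kappa>\<close> q(3)])
  then obtain e1 where e1: "e1 > 0" "\<And>x. x \<noteq> \<kappa> \<Longrightarrow> dist x \<kappa> < e1 \<Longrightarrow> g' x < q"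
    unfolding eventually_at by auto
  define \<epsilon> where "\<epsilon> = min e1 \<epsilon>0 / 2"
  have \<epsilon>: "\<epsilon> > 0" "\<epsilon> < e1" "\<epsilon> < \<epsilon>0" using e0 e1 by (auto simp: \<epsilon>_def)
  have contr: "g v - g u \<le> q * (v - u)" if uv: "\<kappa> - \<epsilon> \<le> u" "u \<le> v" "v \<le> \<kappa>" for u v
  proof (cases "u = v")
    case False
    then have "u < v" using that by simp
    then obtain z where z: "z > u" "z < v" "g v - g u = (v - u) * g' z"
      using MVT2[of u v g g'] g' uv \<epsilon> by force
    have "g' z < q" using z uv \<epsilon> by (intro e1(2)) (auto simp: dist_real_def)
    then show ?thesis using z(3) \<open>u < v\<close> by (simp add: mult.commute mult_right_mono)
  qed simp
  define l m where "l = (c + sqrt (c\<^sup>2 + 4)) / 2" and "m = (c - sqrt (c\<^sup>2 + 4)) / 2"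
  have sq: "(sqrt (c\<^sup>2 + 4))\<^sup>2 = c\<^sup>2 + 4" by (simp add: add_nonneg_nonneg)
  have "c < sqrt (c\<^sup>2 + 4)" by (rule real_less_rsqrt) simp
  then have lm: "l > 0" "m < 0" "l + m = c" "l * m = -1"
    using assms(3) sq by (auto simp: l_def m_def field_simps power2_eq_square)
  interpret delayed_monostable g \<kappa> "c * h" c p l m C \<theta> \<delta> \<epsilon> q
  proof
    show "\<bar>g u - p * u\<bar> \<le> C * u powr (1 + \<theta>)" if "0 < u" "u \<le> \<delta>" for u
    proof -
      have "\<bar>g u - p * u\<bar> = \<bar>g u / u - p\<bar> * u" using that by (simp add: abs_mult_pos' [symmetric] field_simps)
      also have "\<dots> \<le> C * u powr \<theta> * u" using C(4)[OF that] that by (intro mult_right_mono) auto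
      also have "\<dots> = C * u powr (1 + \<theta>)" using that by (simp add: powr_add)
      finally show ?thesis .
    qed
    show "g x \<le> g y" if "0 \<le> x" "x \<le> y" for x y
      using strict_mono_on_leD[OF g] that by auto
  qed (use assms(1,3) g0 \<kappa> p C \<epsilon> q lm contr in auto)
  have front: "\<exists>f1 f2. front f f1 f2" if tf: "traveling_front g \<kappa> h c f" for f
  proof -
    from tf obtain f1 f2 where f: "\<forall>s. (f has_real_derivative f1 s) (at s)" "\<forall>s. (f1 has_real_derivative f2 s) (at s)"
      "\<forall>s. f2 s - c * f1 s - f s + g (f (s - c * h)) = 0"
      unfolding traveling_front_def by blast
    from tf have f0: "\<And>s. 0 < f s" and mo: "mono f \<or> antimono f" and lim: "(f \<longlongrightarrow> 0) at_bot" "(f \<longlongrightarrow> \<kappa>) at_top"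
      unfolding traveling_front_def by auto
    \<comment> \<open>A nonincreasing profile with limit 0 at -infinity could not be
      positive.\<close>
    have "\<not> antimono f"
    proof
      assume an: "antimono f"
      have "f 0 \<le> 0"
        by (rule tendsto_lowerbound[OF lim(1)])
           (use antimonoD[OF an] in \<open>auto simp: eventually_at_bot_linorder\<close>)
      with f0[of 0] show False by simp
    qed
    with mo have mo: "mono f" by simp
    have "f t \<le> \<kappa>" for t
      by (rule tendsto_lowerbound[OF lim(2)])
         (use monoD[OF mo] in \<open>auto simp: eventually_at_top_linorder\<close>)
    then show ?thesis using f f0 mo lim by (auto simp: front_def)
  qed
  show ?thesis using front_unique front[OF assms(4)] front[OF assms(5)] by blast
qed

end
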